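(* Assume that $\nu$ satisfies Assumption (A) and that $\mathcal M$ satisfies Assumption (B). Let $c,C>0$ be the constants of the concentration inequality described in the context. Let $0<\delta<1$ and let $(\delta_n)_{n\in\mathbb{N}^*}\subset(0,1)$ satisfy $\prod_{n\in\mathbb{N}^*}(1-\delta_n)\ge 1-\delta$. For all $n\in\mathbb{N}^*$ let $$K_\infty^{n}:=\max\big(K_\infty,\|\overline g_1\|_{L^\infty},\dots,\|\overline g_n\|_{L^\infty}\big),\qquad K_{\mathcal L}^{n}:=\max\big(K_{\mathcal L},\|\overline g_1\|_{\mathcal L},\dots,\|\overline g_n\|_{\mathcal L}\big).$$ Assume that there exists $0<\gamma<1$ such that for all $n\in\mathbb{N}^*$, $M_n\in\mathbb{N}^*$ is a $\overline Z^{1:(n-1)}$-measurable random variable satisfying almost surely $$M_n\ \ge\ -\ln\!\Big(\frac{\delta_n}{C}\Big)\,\frac{1}{c\,\phi(\kappa_{n-1})},$$ where $$\kappa_0:=\frac{(1-\gamma^2)\,\widehat\sigma_0(\mathcal M)^2}{8K_\infty K_{\mathcal L}},\qquad \kappa_{n-1}:=\frac{\min\Big(\frac{1}{2(n-1)},\ \frac{(1-\gamma^2)\widehat\sigma_{n-1}(\mathcal M)^2}{n(9K_2^2+4)}\Big)}{6K_\infty^{n-1}K_{\mathcal L}^{n-1}}\quad (n\ge 2).$$ Then for all $n\in\mathbb{N}^*$, almost surely, $$\mathbb{P}\Big[\overline\sigma_{n-1}(\mathcal M)\ge\gamma\,\widehat\sigma_{n-1}(\mathcal M)\ \Big|\ \overline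 Z^{1:(n-1)}\Big]\ge 1-\delta_n .$$ Consequently, denoting by $\mathcal G_n$ the event $\{\overline\sigma_{n-1}(\mathcal M)\ge\gamma\,\widehat\sigma_{n-1}(\mathcal M)\}$, one has $\mathbb{P}\big[\bigcap_{n\in\mathbb{N}^*}\mathcal G_n\big]\ge 1-\delta$; i.e. with probability at least $1-\delta$, the MC-greedy algorithm is a weak greedy algorithm with parameter $\gamma$ for the norm $\|\cdot\|_{\overline Z^{1:\infty}}$ (at every iteration $n$, $\overline\sigma_{n-1}(\mathcal M)\ge\gamma\widehat\sigma_{n-1}(\mathcal M)$).
   Context: Setting. Let $d,p\in\mathbb{N}^*$, $(\Omega,\mathcal F,\mathbb{P})$ a probability space, $Z$ an $\mathbb{R}^d$-valued random vector with law $\nu$. Let $L^2_{\nu,0}(\mathbb{R}^d)=\{g\in L^2_\nu(\mathbb{R}^d):\int g\,d\nu=0\}$, a Hilbert space with $\langle g_1,g_2\rangle=\int g_1g_2\,d\nu=\mathrm{Cov}[g_1(Z),g_2(Z)]$ and $\|g\|=\sqrt{\mathrm{Var}[g(Z)]}$. Let $\mathcal P\subset\mathbb{R}^p$ and for each $\mu\in\mathcal P$ let $f_\mu:\mathbb{R}^d\to\mathbb{R}$ be continuous with $f_\mu\in L^2_\nu(\mathbb{R}^d)$; set $g_\mu:=f_\mu-\mathbb{E}[f_\mu(Z)]$ and $\mathcal M:=\{g_\mu:\mu\in\mathcal P\}$. The Kolmogorov $n$-width is $d_n(\mathcal M):=\inf_{V_n}\sup_{\mu\in\mathcal P}\inf_{h\in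 V_n}\|g_\mu-h\|$, the infimum over $n$-dimensional subspaces $V_n\subset L^2_{\nu,0}(\mathbb{R}^d)$. $\mathcal L$ denotes the set of Lipschitz functions on $\mathbb{R}^d$ and $\|f\|_{\mathcal L}$ the Lipschitz constant of $f$. Empirical quantities: for a collection $\overline Z=(Z_k)_{1\le k\le M}$ of random vectors and continuous $f,g$, $\mathbb{E}_{\overline Z}(f)=\frac1M\sum_{k=1}^M f(Z_k)$, $\mathrm{Cov}_{\overline Z}(f,g)=\mathbb{E}_{\overline Z}(fg)-\mathbb{E}_{\overline Z}(f)\mathbb{E}_{\overline Z}(g)$, $\mathrm{Var}_{\overline Z}(f)=\mathrm{Cov}_{\overline Z}(f,f)$. Sampling. $(M_n)_{n\ge1}$ are positive integers (numbers of samples). For $n\ge1$, $\overline Z^n=(Z^n_k)_{1\le k\le M_n}$, where all $Z^n_k$ ($n\ge1$, $1\le k\le M_n$) are i.i.d. with law $\nu$ and independent of $Z$; $\overline Z^{1:n}=(\overline Z^m)_{1\le m\le n}$, $\overline Z^{1:\infty}=(\overline Z^n)_{n\ge1}$. For random functions $g_1,g_2$ with values in $L^2_{\nu,0}(\mathbb{R}^d)$: $\langle g_1,g_2\rangle_{\overline Z^{1:\infty}}=\mathrm{Cov}[g_1(Z),g_2(Z)\mid\overline Z^{1:\infty}]$, $\|g_1\|_{\overline Z^{1:\infty}}=\sqrt{\mathrm{Var}[g_1(Z)\mid\overline Z^{1:\infty}]}$. MC-greedy algorithm: choose $\overline\mu_1\in\operatorname{argmax}_{\mu\in\mathcal P}\mathrm{Var}_{\overline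 Z^1}(g_\mu)$ with $g_{\overline\mu_1}\neq0$ a.s., $\overline V_1=\mathrm{Span}\{g_{\overline\mu_1}\}$; for $n\ge2$ choose $\overline\mu_n\in\operatorname{argmax}_{\mu\in\mathcal P}\inf_{\lambda\in\mathbb{R}^{n-1}}\mathrm{Var}_{\overline Z^n}\big(g_\mu-\sum_{i=1}^{n-1}\lambda_ig_{\overline\mu_i}\big)$ with $g_{\overline\mu_n}\notin\overline V_{n-1}$ a.s., $\overline V_n=\mathrm{Span}\{g_{\overline\mu_1},\dots,g_{\overline\mu_n}\}$. Thus $\overline\mu_n$ is $\overline Z^{1:n}$-measurable. For $n\ge1$: $\widehat\sigma_{n-1}(\mathcal M):=\max_{\mu\in\mathcal P}\inf_{\lambda\in\mathbb{R}^{n-1}}\sqrt{\mathrm{Var}[g_\mu(Z)-\sum_{i=1}^{n-1}\lambda_ig_{\overline\mu_i}(Z)\mid\overline Z^{1:\infty}]}$ and $\overline\sigma_{n-1}(\mathcal M):=\inf_{\lambda\in\mathbb{R}^{n-1}}\sqrt{\mathrm{Var}[g_{\overline\mu_n}(Z)-\sum_{i=1}^{n-1}\lambda_ig_{\overline\mu_i}(Z)\mid\overline Z^{1:\infty}]}$ (for $n=1$ the sums are empty). $(\overline g_n)_{n\ge1}$ is the orthonormal family obtained by Gram–Schmidt orthonormalization of $(g_{\overline\mu_n})_{n\ge1}$ for $\langle\cdot,\cdot\rangle_{\overline Z^{1:\infty}}$; $\overline g_n$ is $\overline Z^{1:n}$-measurable and $\mathrm{Span}\{\overline g_1,\dots,\overline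 g_n\}=\overline V_n$. Assumption (A): there exist $\alpha>1$, $\beta>0$ with $\int_{\mathbb{R}^d}e^{\beta|x|^\alpha}d\nu(x)<\infty$. The function $\phi:(0,\infty)\to(0,\infty)$ is $\phi(\kappa)=\kappa^2\mathbf 1_{\kappa\le1}+\kappa^\alpha\mathbf 1_{\kappa>1}$ if $d=1$; $\phi(\kappa)=(\kappa/\log(2+1/\kappa))^2\mathbf 1_{\kappa\le1}+\kappa^\alpha\mathbf 1_{\kappa>1}$ if $d=2$; $\phi(\kappa)=\kappa^d\mathbf 1_{\kappa\le1}+\kappa^\alpha\mathbf 1_{\kappa>1}$ if $d\ge3$. The constants $c,C>0$ (depending only on $\nu,d,\alpha,\beta$; they exist under (A) by a result of Fournier–Guillin) are such that for every $M\in\mathbb{N}^*$, every i.i.d. $\overline Z=(Z_k)_{1\le k\le M}$ with law $\nu$ and every $\kappa>0$: $\mathbb{P}\big[\sup_{f\in\mathcal L,\|f\|_{\mathcal L}\le1}|\mathbb{E}[f(Z)]-\mathbb{E}_{\overline Z}(f)|\ge\kappa\big]\le Ce^{-cM\phi(\kappa)}$. Assumption (B): (B1) $\mathcal M$ is a compact subset of $L^2_{\nu,0}(\mathbb{R}^d)$, $K_2:=\sup_\mu\|g_\mu\|<\infty$; (B2) $\mathcal M\subset\mathcal L$ and $K_{\mathcal L}:=\sup_\mu\|g_\mu\|_{\mathcal L}<\infty$; (B3) $\mathcal M\subset L^\infty(\mathbb{R}^d)$ and $K_\infty:=\sup_\mu\|g_\mu\|_{L^\infty}<\infty$; (B4)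 $d_n(\mathcal M)>0$ for all $n\in\mathbb{N}^*$. *)

theory Defs
  imports "HOL-Analysis.Analysis" "HOL-Probability.Probability"
begin

definition phi_conc :: "nat \<Rightarrow> real \<Rightarrow> real \<Rightarrow> real" where
  "phi_conc d \<alpha> \<kappa> =
     (if \<kappa> \<le> 1 then
        (if d = 1 then \<kappa>^2
         else if d = 2 then (\<kappa> / ln (2 + 1/\<kappa>))^2
         else \<kappa>^d)
      else \<kappa> powr \<alpha>)"

definition centred :: "'a measure \<Rightarrow> ('a \<Rightarrow> real) \<Rightarrow> 'a \<Rightarrow> real" where
  "centred \<nu> f = (\<lambda>x. f x - (\<integral>y. f y \<partial>\<nu>))"

(* covariance / variance under nu (= the L^2_{nu,0} inner product / squared norm) *)
definition cov_nu :: "'a measure \<Rightarrow> ('a \<Rightarrow> real) \<Rightarrow> ('a \<Rightarrow> real) \<Rightarrow> real" where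
  "cov_nu \<nu> h1 h2 = (\<integral>x. h1 x * h2 x \<partial>\<nu>) - (\<integral>x. h1 x \<partial>\<nu>) * (\<integral>x. h2 x \<partial>\<nu>)"

definition var_nu :: "'a measure \<Rightarrow> ('a \<Rightarrow> real) \<Rightarrow> real" where
  "var_nu \<nu> h = cov_nu \<nu> h h"

definition resid_var_nu :: "'a measure \<Rightarrow> ('a \<Rightarrow> real) \<Rightarrow> (nat \<Rightarrow> 'a \<Rightarrow> real) \<Rightarrow> nat \<Rightarrow> real" where
  "resid_var_nu \<nu> h b n = (INF lam::nat \<Rightarrow> real. var_nu \<nu> (\<lambda>x. h x - (\<Sum>i<n. lam i * b i x)))"

definition emp_mean :: "(nat \<Rightarrow> 'a) \<Rightarrow> nat \<Rightarrow> ('a \<Rightarrow> real) \<Rightarrow> real" where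
  "emp_mean z m h = (\<Sum>k<m. h (z k)) / real m"

definition emp_var :: "(nat \<Rightarrow> 'a) \<Rightarrow> nat \<Rightarrow> ('a \<Rightarrow> real) \<Rightarrow> real" where
  "emp_var z m h = emp_mean z m (\<lambda>x. h x * h x) - emp_mean z m h * emp_mean z m h"

definition emp_resid_var :: "(nat \<Rightarrow> 'a) \<Rightarrow> nat \<Rightarrow> ('a \<Rightarrow> real) \<Rightarrow> (nat \<Rightarrow> 'a \<Rightarrow> real) \<Rightarrow> nat \<Rightarrow> real" where
  "emp_resid_var z m h b n = (INF lam::nat \<Rightarrow> real. emp_var z m (\<lambda>x. h x - (\<Sum>i<n. lam i * b i x)))"

fun gram_schmidt :: "(('a \<Rightarrow> real) \<Rightarrow> ('a \<Rightarrow> real) \<Rightarrow> real) \<Rightarrow> (nat \<Rightarrow> 'a \<Rightarrow> real) \<Rightarrow> nat \<Rightarrow> ('a \<Rightarrow> real) list" where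
  "gram_schmidt ip u 0 = []"
| "gram_schmidt ip u (Suc n) =
     (let prev = gram_schmidt ip u n;
          w = (\<lambda>x. u n x - (\<Sum>e\<leftarrow>prev. ip (u n) e * e x))
      in prev @ [(\<lambda>x. w x / sqrt (ip w w))])"

(* sup norm (L^infty norm of a continuous function) and Lipschitz constant *)
definition linf_norm :: "('a \<Rightarrow> real) \<Rightarrow> real" where
  "linf_norm h = (SUP x. \<bar>h x\<bar>)"

definition lip_const :: "('a::metric_space \<Rightarrow> real) \<Rightarrow> real" where
  "lip_const h = Inf {L. L-lipschitz_on UNIV h}"

definition in_L2_0 :: "'a measure \<Rightarrow> ('a \<Rightarrow> real) \<Rightarrow> bool" where
  "in_L2_0 \<nu> h \<longleftrightarrow> h \<in> borel_measurable \<nu> \<and> integrable \<nu> (\<lambda>x. (h x)^2) \<and> (\<integral>x. h x \<partial>\<nu>) = 0"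

definition L2_lin_indep :: "'a measure \<Rightarrow> (nat \<Rightarrow> 'a \<Rightarrow> real) \<Rightarrow> nat \<Rightarrow> bool" where
  "L2_lin_indep \<nu> b n \<longleftrightarrow>
     (\<forall>c::nat \<Rightarrow> real. (AE x in \<nu>. (\<Sum>i<n. c i * b i x) = 0) \<longrightarrow> (\<forall>i<n. c i = 0))"

(* Kolmogorov n-width of {g mu | mu in P} in L^2_{nu,0} (value in ereal; inf of empty = infinity) *)
definition kolmogorov_width :: "'a measure \<Rightarrow> 'p set \<Rightarrow> ('p \<Rightarrow> 'a \<Rightarrow> real) \<Rightarrow> nat \<Rightarrow> ereal" where
  "kolmogorov_width \<nu> P g n =
     (INF b \<in> {b. (\<forall>i<n. in_L2_0 \<nu> (b i)) \<and> L2_lin_indep \<nu> b n}.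
        (SUP \<mu>\<in>P. ereal (sqrt (resid_var_nu \<nu> (g \<mu>) b n))))"

definition L2_dist :: "'a measure \<Rightarrow> ('a \<Rightarrow> real) \<Rightarrow> ('a \<Rightarrow> real) \<Rightarrow> real" where
  "L2_dist \<nu> h1 h2 = sqrt (\<integral>x. (h1 x - h2 x)^2 \<partial>\<nu>)"

definition L2_compact :: "'a measure \<Rightarrow> 'p set \<Rightarrow> ('p \<Rightarrow> 'a \<Rightarrow> real) \<Rightarrow> bool" where
  "L2_compact \<nu> P g \<longleftrightarrow>
     (\<forall>s::nat \<Rightarrow> 'p. (\<forall>j. s j \<in> P) \<longrightarrow>
        (\<exists>(r::nat \<Rightarrow> nat) \<mu>. strict_mono r \<and> \<mu> \<in> P \<and> (\<lambda>j. L2_dist \<nu> (g (s (r j))) (g \<mu>)) \<longlonglongrightarrow> 0))"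

definition sample_alg :: "'w measure \<Rightarrow> (nat \<Rightarrow> nat \<Rightarrow> 'w \<Rightarrow> 'a::topological_space) \<Rightarrow> nat \<Rightarrow> 'w measure" where
  "sample_alg M Zs m =
     sigma (space M) {Zs j k -` A \<inter> space M | j k A. 1 \<le> j \<and> j \<le> m \<and> A \<in> sets borel}"

end

theory Submission
  imports Defs
begin

text \<open>
  On the event that the empirical measure of the \<open>n\<close>-th batch is within \<open>\<kappa>\<close> of \<open>\<nu>\<close> in the
  dual norm of the 1-Lipschitz functions, all covariances between \<open>g \<mu>\<close> and the orthonormal
  functions differ from their empirical versions by at most \<open>\<eta> = 3 K L \<kappa>\<close>. Hence the variance of
  \<open>h - (\<Sum>i<m. a i * e i)\<close> is perturbed by at most \<open>\<eta> (m + 1) (1 + |a|\<^sup>2)\<close>, so that the empirical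
  argmax is nearly optimal. The batch is independent of the past, whereas \<open>\<kappa>\<close> and the batch
  size \<open>M\<close> depend on the past. Conditioning on \<open>M = m\<close>, the threshold \<open>\<kappa>\<close> is only known to lie in the
  deterministic set \<open>S m\<close> of all thresholds for which \<open>m\<close> samples suffice; the deviation exceeds some
  element of \<open>S m\<close> with probability at most \<open>\<delta>\<close>, which makes the measurability of \<open>\<kappa>\<close> irrelevant.
\<close>

subsection \<open>Covariances of bounded Lipschitz functions\<close>

text \<open>The factor 3 in \<open>\<eta>\<close> is 2 + 1: the product of two functions bounded by
  K with Lipschitz constant L has Lipschitz constant 2KL, and in the product of the two empirical
  means one factor is itself a deviation, because the mean under \<nu> vanishes. The two entries of
  the minimum in \<kappa> have separate tasks: the first makes the error relative to the squared
  coefficients at most 1/2, the second keeps the remaining additive error below the gap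
  \<open>(1 - \<gamma>^2) * \<sigma>^2\<close>. Functions are handled pointwise, in the vector space
  \<open>blip0\<close>, since empirical means do not descend to classes modulo null sets. The greedy
  inequality is shown for one outcome at a time. Its probability is kept in the integrated form
  \<open>(1 - \<delta>s n) * prob A \<le> prob (A \<inter> G n)\<close> for all events A of the
  past: this gives the conditional bound, and with A the intersection of the earlier
  \<open>G i\<close> it gives the product bound. It requires \<open>G n\<close> to be measurable
  although it involves an infimum and a supremum over uncountable sets; the former has a closed
  formula, the latter reduces to a countable dense set.\<close>

definition blip0 :: "'a::metric_space measure \<Rightarrow> ('a \<Rightarrow> real) set" where
  "blip0 \<nu> = {h. (\<exists>L. L-lipschitz_on UNIV h) \<and> bounded (range h) \<and> (\<integral>x. h x \<partial>\<nu>) = 0}"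

definition emp_cov :: "(nat \<Rightarrow> 'a) \<Rightarrow> nat \<Rightarrow> ('a \<Rightarrow> real) \<Rightarrow> ('a \<Rightarrow> real) \<Rightarrow> real" where
  "emp_cov z m h1 h2 = emp_mean z m (\<lambda>x. h1 x * h2 x) - emp_mean z m h1 * emp_mean z m h2"

lemma emp_var_eq_emp_cov: "emp_var z m h = emp_cov z m h h"
  by (simp add: emp_var_def emp_cov_def)

lemma emp_mean_sum:
  "emp_mean z m (\<lambda>x. \<Sum>i\<in>I. a i * v i x) = (\<Sum>i\<in>I. a i * emp_mean z m (v i))"
  by (simp add: emp_mean_def sum_divide_distrib[symmetric] sum_distrib_left sum.swap[of _ I])

lemma emp_cov_sum:
  "emp_cov z m (\<lambda>x. \<Sum>i\<in>I. a i * v i x) (\<lambda>x. \<Sum>j\<in>J. b j * w j x)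
    = (\<Sum>i\<in>I. \<Sum>j\<in>J. a i * b j * emp_cov z m (v i) (w j))"
proof -
  have "emp_mean z m (\<lambda>x. (\<Sum>i\<in>I. a i * v i x) * (\<Sum>j\<in>J. b j * w j x))
      = emp_mean z m (\<lambda>x. \<Sum>p\<in>I\<times>J. (a (fst p) * b (snd p)) * (v (fst p) x * w (snd p) x))"
    by (simp add: sum_product sum.cartesian_product case_prod_unfold mult_ac)
  also have "\<dots> = (\<Sum>i\<in>I. \<Sum>j\<in>J. a i * b j * emp_mean z m (\<lambda>x. v i x * w j x))"
    by (simp add: emp_mean_sum[where v = "\<lambda>p x. v (fst p) x * w (snd p) x"]
        sum.cartesian_product case_prod_unfold)
  finally show ?thesis
    by (simp add: emp_cov_def emp_mean_sum sum_product right_diff_distrib sum_subtractf mult_ac)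
qed

text \<open>Cauchy-Schwarz against the constant 1. The bound makes the infimum in
  \<open>emp_resid_var\<close> one over a set bounded below, so that it lies below each
  competitor.\<close>

lemma emp_var_nonneg: "0 \<le> emp_var z m h"
proof (cases "m = 0")
  case False
  let ?S = "\<Sum>k<m. h (z k)" and ?Q = "\<Sum>k<m. h (z k) * h (z k)"
  have "?S * ?S \<le> real m * ?Q"
    using Cauchy_Schwarz_ineq_sum[of "\<lambda>_. 1" "\<lambda>k. h (z k)" "{..<m}"]
    by (simp add: power2_eq_square)
  then have "?S * ?S / (real m * real m) \<le> ?Q / real m"
    using False by (simp add: field_simps)
  then show ?thesis
    by (simp add: emp_var_def emp_mean_def)
qed (simp add: emp_var_def emp_mean_def)

locale borel_prob_space = prob_space \<nu> for \<nu> :: "'a::euclidean_space measure" +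
  assumes sets_borel [measurable_cong]: "sets \<nu> = sets borel"
begin

lemma blip0_continuous: "h \<in> blip0 \<nu> \<Longrightarrow> continuous_on UNIV h"
  by (auto simp: blip0_def intro: lipschitz_on_continuous_on)

lemma blip0_measurable [measurable_dest]: "h \<in> blip0 \<nu> \<Longrightarrow> h \<in> borel_measurable borel"
  by (auto intro: borel_measurable_continuous_onI blip0_continuous)

lemma integrable_blip0_aux:
  assumes "h \<in> borel_measurable borel" "bounded (range h)"
  shows "integrable \<nu> (h :: 'a \<Rightarrow> real)"
proof -
  obtain B where "\<And>x. \<bar>h x\<bar> \<le> B"
    using assms(2) by (auto simp: bounded_iff)
  then show ?thesis
    using assms(1) by (intro integrable_const_bound[where B = B]) (auto simp: measurable_def sets_borel space_borel sets_eq_imp_space_eq[OF sets_borel])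
qed

lemma integrable_blip0: "h \<in> blip0 \<nu> \<Longrightarrow> integrable \<nu> h"
  by (intro integrable_blip0_aux) (auto simp: blip0_measurable, auto simp: blip0_def)

lemma integrable_blip0_mult:
  assumes "h \<in> blip0 \<nu>" "k \<in> blip0 \<nu>"
  shows "integrable \<nu> (\<lambda>x. h x * k x)"
proof (rule integrable_blip0_aux)
  show "(\<lambda>x. h x * k x) \<in> borel_measurable borel"
    using assms by (auto intro!: borel_measurable_times blip0_measurable)
  obtain B C where BC: "\<And>x. \<bar>h x\<bar> \<le> B" "\<And>x. \<bar>k x\<bar> \<le> C"
    using assms by (auto simp: blip0_def bounded_iff)
  have "\<bar>h x * k x\<bar> \<le> B * C" for x
    unfolding abs_mult by (intro mult_mono BC order_trans[OF _ BC(1)]) auto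
  then show "bounded (range (\<lambda>x. h x * k x))"
    by (auto simp: bounded_iff)
qed

lemma zero_blip0: "(\<lambda>x. 0) \<in> blip0 \<nu>"
  by (auto simp: blip0_def intro: lipschitz_on_constant)

lemma blip0_add:
  assumes "h \<in> blip0 \<nu>" "k \<in> blip0 \<nu>"
  shows "(\<lambda>x. h x + k x) \<in> blip0 \<nu>"
proof -
  obtain L1 L2 where "L1-lipschitz_on UNIV h" "L2-lipschitz_on UNIV k"
    using assms by (auto simp: blip0_def)
  then have "(L1 + L2)-lipschitz_on UNIV (\<lambda>x. h x + k x)"
    by (rule lipschitz_on_add)
  moreover have "bounded (range (\<lambda>x. h x + k x))"
    using assms by (intro bounded_plus_comp) (auto simp: blip0_def)
  ultimately show ?thesis
    using assms integrable_blip0[OF assms(1)] integrable_blip0[OF assms(2)]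
    by (auto simp: blip0_def)
qed

lemma blip0_scale:
  assumes "h \<in> blip0 \<nu>"
  shows "(\<lambda>x. a * h x) \<in> blip0 \<nu>"
proof -
  obtain L where "L-lipschitz_on UNIV h"
    using assms by (auto simp: blip0_def)
  then have "(\<bar>a\<bar> * L)-lipschitz_on UNIV (\<lambda>x. a * h x)"
    by (rule lipschitz_on_cmult_real)
  moreover have "bounded (range (\<lambda>x. a * h x))"
    using assms bounded_scaling[of "range h" a] by (auto simp: blip0_def image_image)
  ultimately show ?thesis
    using assms by (auto simp: blip0_def)
qed

lemma blip0_sum:
  "(\<And>i. i \<in> I \<Longrightarrow> v i \<in> blip0 \<nu>) \<Longrightarrow> (\<lambda>x. \<Sum>i\<in>I. a i * v i x) \<in> blip0 \<nu>"
proof (induction I rule: infinite_finite_induct)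
  case (insert i I)
  then show ?case
    using blip0_add[OF blip0_scale[of "v i" "a i"], of "\<lambda>x. \<Sum>i\<in>I. a i * v i x"] by simp
qed (auto simp: zero_blip0)

lemma blip0_diff: "h \<in> blip0 \<nu> \<Longrightarrow> k \<in> blip0 \<nu> \<Longrightarrow> (\<lambda>x. h x - k x) \<in> blip0 \<nu>"
  using blip0_add[of h "\<lambda>x. -1 * k x"] blip0_scale[of k "-1"] by simp

lemma cov_blip0: "h \<in> blip0 \<nu> \<Longrightarrow> cov_nu \<nu> h k = (\<integral>x. h x * k x \<partial>\<nu>)"
  by (simp add: cov_nu_def blip0_def)

lemma cov_sym: "cov_nu \<nu> h k = cov_nu \<nu> k h"
  by (simp add: cov_nu_def mult.commute)

lemma cov_add_left:
  "h \<in> blip0 \<nu> \<Longrightarrow> k \<in> blip0 \<nu> \<Longrightarrow> l \<in> blip0 \<nu> \<Longrightarrow>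
    cov_nu \<nu> (\<lambda>x. h x + k x) l = cov_nu \<nu> h l + cov_nu \<nu> k l"
  by (simp add: cov_blip0 blip0_add distrib_right integrable_blip0_mult)

lemma cov_scale_left: "h \<in> blip0 \<nu> \<Longrightarrow> cov_nu \<nu> (\<lambda>x. a * h x) l = a * cov_nu \<nu> h l"
  by (simp add: cov_blip0 blip0_scale mult.assoc)

lemma cov_zero_left: "cov_nu \<nu> (\<lambda>x. 0) l = 0"
  by (simp add: cov_nu_def)

lemma cov_sum_left:
  assumes "\<And>i. i \<in> I \<Longrightarrow> v i \<in> blip0 \<nu>" "l \<in> blip0 \<nu>"
  shows "cov_nu \<nu> (\<lambda>x. \<Sum>i\<in>I. a i * v i x) l = (\<Sum>i\<in>I. a i * cov_nu \<nu> (v i) l)"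
  using assms
  by (induction I rule: infinite_finite_induct)
     (auto simp: cov_zero_left cov_add_left cov_scale_left blip0_scale blip0_sum)

lemma cov_diff_left:
  "h \<in> blip0 \<nu> \<Longrightarrow> k \<in> blip0 \<nu> \<Longrightarrow> l \<in> blip0 \<nu> \<Longrightarrow>
    cov_nu \<nu> (\<lambda>x. h x - k x) l = cov_nu \<nu> h l - cov_nu \<nu> k l"
  using cov_add_left[of h "\<lambda>x. -1 * k x" l] cov_scale_left[of k "-1" l] blip0_scale[of k "-1"] by simp

lemma cov_sum:
  assumes "\<And>i. i \<in> I \<Longrightarrow> v i \<in> blip0 \<nu>" "\<And>j. j \<in> J \<Longrightarrow> w j \<in> blip0 \<nu>"
  shows "cov_nu \<nu> (\<lambda>x. \<Sum>i\<in>I. a i * v i x) (\<lambda>x. \<Sum>j\<in>J. b j * w j x)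
    = (\<Sum>i\<in>I. \<Sum>j\<in>J. a i * b j * cov_nu \<nu> (v i) (w j))"
proof -
  have "cov_nu \<nu> (v i) (\<lambda>x. \<Sum>j\<in>J. b j * w j x) = (\<Sum>j\<in>J. b j * cov_nu \<nu> (v i) (w j))" if "i \<in> I" for i
    using cov_sum_left[where I = J and v = w and l = "v i" and a = b, OF assms(2)] assms(1)[OF that] by (simp add: cov_sym[of "v i"])
  then show ?thesis
    by (simp add: cov_sum_left blip0_sum assms sum_distrib_left mult.assoc)
qed

lemma var_nonneg: "h \<in> blip0 \<nu> \<Longrightarrow> 0 \<le> var_nu \<nu> h"
  by (simp add: var_nu_def cov_blip0)

lemma var_eq_0_imp_AE:
  assumes "h \<in> blip0 \<nu>" "var_nu \<nu> h = 0"
  shows "AE x in \<nu>. h x = 0"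
  using assms integral_nonneg_eq_0_iff_AE[OF integrable_blip0_mult[OF assms(1) assms(1)]]
  by (auto simp: var_nu_def cov_blip0)

text \<open>The degenerate case of Cauchy-Schwarz: such an \<open>h\<close> vanishes almost
  everywhere, though perhaps not everywhere. It disposes of Gram-Schmidt residuals of variance
  0.\<close>

lemma cov_eq_0_if_var_0:
  assumes "h \<in> blip0 \<nu>" "var_nu \<nu> h = 0"
  shows "cov_nu \<nu> k h = 0"
proof -
  have "(\<integral>x. h x * k x \<partial>\<nu>) = 0"
    using var_eq_0_imp_AE[OF assms] by (intro integral_eq_zero_AE) auto
  then show ?thesis
    using assms by (simp add: cov_sym[of k] cov_blip0)
qed

lemma var_add_orth:
  assumes "h \<in> blip0 \<nu>" "k \<in> blip0 \<nu>" "cov_nu \<nu> h k = 0"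
  shows "var_nu \<nu> (\<lambda>x. h x + k x) = var_nu \<nu> h + var_nu \<nu> k"
  using assms
  by (simp add: var_nu_def cov_add_left blip0_add cov_sym[of h "\<lambda>x. h x + k x"]
      cov_sym[of k "\<lambda>x. h x + k x"] cov_sym[of k h])

end

subsection \<open>Gram--Schmidt orthonormalization and residual variances\<close>

text \<open>The linear span, as a set of functions. Residual variances are infima over this set, so
  they are unaffected by a change of basis that preserves it.\<close>

definition comb :: "(nat \<Rightarrow> 'a \<Rightarrow> real) \<Rightarrow> nat \<Rightarrow> ('a \<Rightarrow> real) set" where
  "comb u n = range (\<lambda>a x. \<Sum>i<n. a i * u i x)"

lemma combI: "(\<lambda>x. \<Sum>i<n. a i * u i x) \<in> comb u n"
  by (auto simp: comb_def)

lemma comb_base: "i < n \<Longrightarrow> u i \<in> comb u n"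
proof -
  assume "i < n"
  then have "u i = (\<lambda>x. \<Sum>j<n. (if j = i then 1 else 0) * u j x)"
    by (auto simp: if_distrib[of "\<lambda>t. t * _"] cong: if_cong)
  then show ?thesis
    using combI by metis
qed

lemma comb_zero: "(\<lambda>x. 0) \<in> comb u n"
  using combI[of "\<lambda>_. 0" u n] by simp

lemma comb_add: "h \<in> comb u n \<Longrightarrow> k \<in> comb u n \<Longrightarrow> (\<lambda>x. h x + k x) \<in> comb u n"
proof -
  assume "h \<in> comb u n" "k \<in> comb u n"
  then obtain a b where "h = (\<lambda>x. \<Sum>i<n. a i * u i x)" "k = (\<lambda>x. \<Sum>i<n. b i * u i x)"
    by (auto simp: comb_def)
  then show ?thesis
    using combI[of "\<lambda>i. a i + b i" u n] by (simp add: distrib_right sum.distrib)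
qed

lemma comb_scale: "h \<in> comb u n \<Longrightarrow> (\<lambda>x. c * h x) \<in> comb u n"
proof -
  assume "h \<in> comb u n"
  then obtain a where "h = (\<lambda>x. \<Sum>i<n. a i * u i x)"
    by (auto simp: comb_def)
  then show ?thesis
    using combI[of "\<lambda>i. c * a i" u n] by (simp add: sum_distrib_left mult.assoc)
qed

lemma comb_sum: "(\<And>i. i \<in> I \<Longrightarrow> v i \<in> comb u n) \<Longrightarrow> (\<lambda>x. \<Sum>i\<in>I. a i * v i x) \<in> comb u n"
proof (induction I rule: infinite_finite_induct)
  case (insert i I)
  then show ?case
    using comb_add[OF comb_scale[of "v i" u n "a i"], of "\<lambda>x. \<Sum>i\<in>I. a i * v i x"] by simp
qed (auto simp: comb_zero)

lemma comb_diff: "h \<in> comb u n \<Longrightarrow> k \<in> comb u n \<Longrightarrow> (\<lambda>x. h x - k x) \<in> comb u n"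
  using comb_add[of h u n "\<lambda>x. -1 * k x"] comb_scale[of k u n "-1"] by simp

lemma comb_mono:
  assumes "m \<le> n"
  shows "comb u m \<subseteq> comb u n"
proof
  fix h assume "h \<in> comb u m"
  then obtain a where h: "h = (\<lambda>x. \<Sum>i<m. a i * u i x)"
    by (auto simp: comb_def)
  show "h \<in> comb u n"
    unfolding h by (rule comb_sum) (use assms in \<open>auto intro: comb_base\<close>)
qed

lemma comb_subset: "(\<And>i. i < n \<Longrightarrow> v i \<in> comb u m) \<Longrightarrow> comb v n \<subseteq> comb u m"
  by (auto simp: comb_def[of v] intro!: comb_sum)

lemma resid_var_comb: "resid_var_nu \<nu> h u n = (INF v\<in>comb u n. var_nu \<nu> (\<lambda>x. h x - v x))"
  by (simp add: resid_var_nu_def comb_def image_image)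

lemma emp_resid_var_comb: "emp_resid_var z m h u n = (INF v\<in>comb u n. emp_var z m (\<lambda>x. h x - v x))"
  by (simp add: emp_resid_var_def comb_def image_image)

text \<open>The list \<open>gram_schmidt ip u n\<close> only grows at its end, so its entries form a
  single sequence independent of the length.\<close>

definition gs :: "(('a \<Rightarrow> real) \<Rightarrow> ('a \<Rightarrow> real) \<Rightarrow> real) \<Rightarrow> (nat \<Rightarrow> 'a \<Rightarrow> real) \<Rightarrow> nat \<Rightarrow> 'a \<Rightarrow> real" where
  "gs ip u n = gram_schmidt ip u (Suc n) ! n"

text \<open>The residual of \<open>h\<close> after projection onto the first n Gram-Schmidt vectors,
  not the projection itself.\<close>

definition gs_proj ::
    "(('a \<Rightarrow> real) \<Rightarrow> ('a \<Rightarrow> real) \<Rightarrow> real) \<Rightarrow> (nat \<Rightarrow> 'a \<Rightarrow> real) \<Rightarrow> ('a \<Rightarrow> real) \<Rightarrow> nat \<Rightarrow> 'a \<Rightarrow> real" where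
  "gs_proj ip u h n = (\<lambda>x. h x - (\<Sum>i<n. ip h (gs ip u i) * gs ip u i x))"

lemma length_gram_schmidt [simp]: "length (gram_schmidt ip u n) = n"
  by (induction n) (auto simp: Let_def)

lemma gram_schmidt_eq_map: "gram_schmidt ip u n = map (gs ip u) [0..<n]"
proof (induction n)
  case (Suc n)
  have "gram_schmidt ip u (Suc n) = gram_schmidt ip u n @ [gram_schmidt ip u (Suc n) ! n]"
    by (simp add: Let_def nth_append)
  then show ?case
    using Suc by (simp add: gs_def)
qed simp

lemma gs_rec:
  "gs ip u n = (\<lambda>x. gs_proj ip u (u n) n x / sqrt (ip (gs_proj ip u (u n) n) (gs_proj ip u (u n) n)))"
proof -
  have "(\<Sum>e\<leftarrow>gram_schmidt ip u n. ip (u n) e * e x) = (\<Sum>i<n. ip (u n) (gs ip u i) * gs ip u i x)" for x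
    by (simp add: gram_schmidt_eq_map sum_list_sum_nth atLeast0LessThan)
  then show ?thesis
    by (simp add: gs_def[of ip u n] Let_def nth_append gs_proj_def)
qed

lemma gs_in_comb: "gs ip u n \<in> comb u (Suc n)"
proof (induction n rule: less_induct)
  case (less n)
  have "gs ip u i \<in> comb u (Suc n)" if "i < n" for i
    using less[OF that] comb_mono[of "Suc i" "Suc n" u] that by auto
  then have "gs_proj ip u (u n) n \<in> comb u (Suc n)"
    unfolding gs_proj_def by (intro comb_diff comb_sum comb_base) auto
  then show ?case
    using comb_scale[of "gs_proj ip u (u n) n" u "Suc n" "1 / sqrt (ip (gs_proj ip u (u n) n) (gs_proj ip u (u n) n))"]
    by (subst gs_rec) simp
qed

text \<open>This inclusion holds for every \<open>u\<close>. The reverse one can fail when a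
  residual is a nonzero function of variance 0, since it is then normalized to the zero
  function.\<close>

lemma comb_gs_subset: "comb (gs ip u) n \<subseteq> comb u n"
proof (rule comb_subset)
  fix i assume "i < n"
  then show "gs ip u i \<in> comb u n"
    using gs_in_comb[of ip u i] comb_mono[of "Suc i" n u] by auto
qed

section \<open>Orthogonality, Pythagoras and the closed formula for residual variances\<close>

context borel_prob_space
begin

lemma comb_blip0: "(\<And>i. i < n \<Longrightarrow> u i \<in> blip0 \<nu>) \<Longrightarrow> comb u n \<subseteq> blip0 \<nu>"
  by (auto simp: comb_def intro!: blip0_sum)

context
  fixes u :: "nat \<Rightarrow> 'a \<Rightarrow> real"
  assumes u: "\<And>i. u i \<in> blip0 \<nu>"
begin

abbreviation "onb \<equiv> gs (cov_nu \<nu>) u"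
abbreviation "gs_resid \<equiv> gs_proj (cov_nu \<nu>) u"

lemma gs_blip0: "onb i \<in> blip0 \<nu>"
  using gs_in_comb[of "cov_nu \<nu>" u i] comb_blip0[of "Suc i" u] u by auto

lemma gs_proj_blip0: "h \<in> blip0 \<nu> \<Longrightarrow> gs_resid h n \<in> blip0 \<nu>"
  unfolding gs_proj_def by (intro blip0_diff blip0_sum gs_blip0)

lemma gs_eq_0: "var_nu \<nu> (gs_resid (u i) i) = 0 \<Longrightarrow> onb i = (\<lambda>x. 0)"
  by (subst gs_rec) (simp add: var_nu_def)

lemma gs_proj_eq: "var_nu \<nu> (gs_resid (u i) i) \<noteq> 0 \<Longrightarrow>
    gs_resid (u i) i = (\<lambda>x. sqrt (var_nu \<nu> (gs_resid (u i) i)) * onb i x)"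
  by (simp add: gs_rec[of _ u i] var_nu_def)

text \<open>
  Since \<open>x / 0 = 0\<close>, a Gram--Schmidt vector of variance \<open>0\<close> is the zero function, so the formulas
  below need no linear independence of \<open>u\<close>. This is essential for measurability: degenerate \<open>u\<close> are
  excluded only almost surely.
\<close>

definition "gs_sqnorm i = (if var_nu \<nu> (gs_resid (u i) i) = 0 then 0 else 1 :: real)"

lemma cov_gs_self: "cov_nu \<nu> (onb i) (onb i) = gs_sqnorm i"
proof (cases "var_nu \<nu> (gs_resid (u i) i) = 0")
  case True
  then show ?thesis
    by (simp add: gs_eq_0 cov_zero_left gs_sqnorm_def)
next
  case False
  let ?w = "gs_resid (u i) i"
  let ?s = "sqrt (var_nu \<nu> ?w)"
  have pos: "?s > 0"
    using False var_nonneg[OF gs_proj_blip0[OF u[of i], of i]] by simp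
  have "var_nu \<nu> ?w = cov_nu \<nu> (\<lambda>x. ?s * onb i x) (\<lambda>x. ?s * onb i x)"
    using gs_proj_eq[OF False] by (metis var_nu_def)
  also have "\<dots> = ?s * (?s * cov_nu \<nu> (onb i) (onb i))"
    by (simp only: cov_scale_left[OF gs_blip0] cov_sym[of "onb i" "\<lambda>x. ?s * onb i x"])
  also have "\<dots> = (?s * ?s) * cov_nu \<nu> (onb i) (onb i)"
    by (simp only: mult.assoc)
  also have "?s * ?s = var_nu \<nu> ?w"
    using pos by simp
  finally show ?thesis
    using False by (simp add: gs_sqnorm_def)
qed

lemma cov_gs_proj_left:
  assumes "h \<in> blip0 \<nu>" "l \<in> blip0 \<nu>"
  shows "cov_nu \<nu> (gs_resid h n) l = cov_nu \<nu> h l - (\<Sum>i<n. cov_nu \<nu> h (onb i) * cov_nu \<nu> (onb i) l)"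
  unfolding gs_proj_def using assms
  by (simp add: cov_diff_left cov_sum_left blip0_sum gs_blip0)

text \<open>A degenerate \<open>onb i\<close> is the zero function, so the coefficient vanishes
  whenever the weight does. Hence Bessel sums carry no weights.\<close>

lemma cov_gs_sqnorm: "cov_nu \<nu> h (onb i) * gs_sqnorm i = cov_nu \<nu> h (onb i)"
  by (simp add: gs_sqnorm_def gs_eq_0 cov_sym[of h] cov_zero_left)

text \<open>Orthogonality of the vectors is a hypothesis here so that the same computation serves
  inside the induction that proves it, and again once it is known for all indices.\<close>

lemma cov_gs_aux:
  assumes "h \<in> blip0 \<nu>" "j < n"
    and orth: "\<And>i. i < n \<Longrightarrow> i \<noteq> j \<Longrightarrow> cov_nu \<nu> (onb i) (onb j) = 0"
  shows "cov_nu \<nu> (gs_resid h n) (onb j) = 0"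
proof -
  have "(\<Sum>i<n. cov_nu \<nu> h (onb i) * cov_nu \<nu> (onb i) (onb j)) =
      (\<Sum>i<n. if i = j then cov_nu \<nu> h (onb j) else 0)"
    using orth by (intro sum.cong) (auto simp: cov_gs_self cov_gs_sqnorm)
  then show ?thesis
    using assms(1,2) by (simp add: cov_gs_proj_left gs_blip0)
qed

lemma cov_gs_orth: "i < j \<Longrightarrow> cov_nu \<nu> (onb j) (onb i) = 0"
proof (induction j arbitrary: i rule: less_induct)
  case (less j)
  have "cov_nu \<nu> (onb k) (onb i) = 0" if "k < j" "k \<noteq> i" for k
    using less.IH[of k i] less.IH[of i k] that less.prems cov_sym[of "onb k" "onb i"]
    by (cases "i < k") auto
  then have "cov_nu \<nu> (gs_resid (u j) j) (onb i) = 0"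
    by (intro cov_gs_aux u less.prems)
  moreover have "onb j = (\<lambda>x. (1 / sqrt (var_nu \<nu> (gs_resid (u j) j))) * gs_resid (u j) j x)"
    by (subst gs_rec) (simp add: var_nu_def)
  ultimately show ?case
    by (metis cov_scale_left gs_proj_blip0 mult_zero_right u)
qed

lemma cov_gs: "cov_nu \<nu> (onb i) (onb j) = (if i = j then gs_sqnorm i else 0)"
  using cov_gs_orth[of i j] cov_gs_orth[of j i] cov_sym[of "onb i" "onb j"]
  by (cases i j rule: linorder_cases) (auto simp: cov_gs_self)

lemma cov_gs_proj_gs: "h \<in> blip0 \<nu> \<Longrightarrow> j < n \<Longrightarrow> cov_nu \<nu> (gs_resid h n) (onb j) = 0"
  by (rule cov_gs_aux) (auto simp: cov_gs)

lemma cov_gs_proj_base: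
  assumes "h \<in> blip0 \<nu>" "j < n"
  shows "cov_nu \<nu> (gs_resid h n) (u j) = 0"
proof -
  \<comment> \<open>\<open>u j\<close> is the sum of its own residual and a combination of earlier
    \<open>onb i\<close>. If the residual is degenerate, it is not a multiple of
    \<open>onb j\<close>, but it is almost everywhere 0 and has covariance 0 with
    everything.\<close>
  have w: "cov_nu \<nu> (gs_resid (u j) j) (gs_resid h n) = 0"
  proof (cases "var_nu \<nu> (gs_resid (u j) j) = 0")
    case True
    then show ?thesis
      using cov_eq_0_if_var_0[OF gs_proj_blip0[OF u]] cov_sym by metis
  next
    case False
    show ?thesis
      using cov_gs_proj_gs[OF assms] cov_sym[of "onb j"]
      by (subst gs_proj_eq[OF False]) (simp add: cov_scale_left gs_blip0)
  qed
  have "cov_nu \<nu> (onb i) (gs_resid h n) = 0" if "i < j" for i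
    using cov_gs_proj_gs[OF assms(1), of i n] assms(2) that cov_sym by (metis less_trans)
  then have "(\<Sum>i<j. cov_nu \<nu> (u j) (onb i) * cov_nu \<nu> (onb i) (gs_resid h n)) = 0"
    by (intro sum.neutral) auto
  then have "cov_nu \<nu> (u j) (gs_resid h n) = 0"
    using w by (simp add: cov_gs_proj_left gs_proj_blip0 u assms)
  then show ?thesis
    using cov_sym by metis
qed

lemma cov_gs_proj_comb:
  assumes "h \<in> blip0 \<nu>" "v \<in> comb u n"
  shows "cov_nu \<nu> (gs_resid h n) v = 0"
proof -
  obtain a where "v = (\<lambda>x. \<Sum>i<n. a i * u i x)"
    using assms(2) by (auto simp: comb_def)
  then show ?thesis
    using cov_gs_proj_base[OF assms(1), of _ n]
      cov_sum_left[of "{..<n}" u "gs_resid h n" a] cov_sym[of "u _" "gs_resid h n"] cov_sym[of v "gs_resid h n"]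
      u gs_proj_blip0[OF assms(1), of n]
    by (metis (no_types, lifting) lessThan_iff mult_zero_right sum.neutral)
qed

lemma gs_proj_diff_comb: "(\<lambda>x. h x - gs_resid h n x) \<in> comb u n"
proof -
  have "(\<lambda>x. h x - gs_resid h n x) \<in> comb (gs (cov_nu \<nu>) u) n"
    by (simp add: gs_proj_def combI)
  then show ?thesis
    using comb_gs_subset by blast
qed

lemma var_diff_comb:
  assumes "h \<in> blip0 \<nu>" "v \<in> comb u n"
  shows "var_nu \<nu> (\<lambda>x. h x - v x) = var_nu \<nu> (gs_resid h n) + var_nu \<nu> (\<lambda>x. h x - gs_resid h n x - v x)"
proof -
  have c: "(\<lambda>x. h x - gs_resid h n x - v x) \<in> comb u n"
    using comb_diff[OF gs_proj_diff_comb assms(2)] .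
  then have "(\<lambda>x. h x - gs_resid h n x - v x) \<in> blip0 \<nu>"
    using comb_blip0 u by blast
  then have "var_nu \<nu> (\<lambda>x. gs_resid h n x + (h x - gs_resid h n x - v x)) = var_nu \<nu> (gs_resid h n) + var_nu \<nu> (\<lambda>x. h x - gs_resid h n x - v x)"
    by (intro var_add_orth gs_proj_blip0 assms cov_gs_proj_comb c)
  then show ?thesis
    by simp
qed

lemma resid_var_eq_gs_proj:
  assumes "h \<in> blip0 \<nu>"
  shows "resid_var_nu \<nu> h u n = var_nu \<nu> (gs_resid h n)"
  unfolding resid_var_comb
proof (rule cInf_eq_minimum)
  show "var_nu \<nu> (gs_resid h n) \<in> (\<lambda>v. var_nu \<nu> (\<lambda>x. h x - v x)) ` comb u n"
    using gs_proj_diff_comb[of h n] by (intro image_eqI[where x = "\<lambda>x. h x - gs_resid h n x"]) auto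
next
  fix y assume "y \<in> (\<lambda>v. var_nu \<nu> (\<lambda>x. h x - v x)) ` comb u n"
  then obtain v where v: "v \<in> comb u n" "y = var_nu \<nu> (\<lambda>x. h x - v x)"
    by auto
  have "(\<lambda>x. h x - gs_resid h n x - v x) \<in> blip0 \<nu>"
    using comb_diff[OF gs_proj_diff_comb[of h n] v(1)] comb_blip0 u by blast
  then show "var_nu \<nu> (gs_resid h n) \<le> y"
    using var_diff_comb[OF assms v(1)] var_nonneg v(2) by fastforce
qed

text \<open>The infimum is attained at the orthogonal projection, and Pythagoras turns its value
  into the defect in Bessel's inequality. Measurability is read off from this finite expression, and
  nonnegativity of the left side bounds the squared coefficients.\<close>

lemma resid_var_eq:
  assumes "h \<in> blip0 \<nu>"
  shows "resid_var_nu \<nu> h u n = var_nu \<nu> h - (\<Sum>i<n. (cov_nu \<nu> h (onb i))\<^sup>2)"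
proof -
  have *: "cov_nu \<nu> (gs_resid h n) (\<lambda>x. h x - gs_resid h n x) = 0"
    by (rule cov_gs_proj_comb[OF assms gs_proj_diff_comb])
  have "cov_nu \<nu> h (gs_resid h n) = cov_nu \<nu> (gs_resid h n) (gs_resid h n)"
    using * cov_diff_left[OF assms gs_proj_blip0[OF assms, of n] gs_proj_blip0[OF assms, of n]]
      cov_sym[of "gs_resid h n" "\<lambda>x. h x - gs_resid h n x"] by linarith
  then have "var_nu \<nu> (gs_resid h n) = cov_nu \<nu> (gs_resid h n) h"
    by (metis var_nu_def cov_sym)
  also have "\<dots> = cov_nu \<nu> h h - (\<Sum>i<n. cov_nu \<nu> h (onb i) * cov_nu \<nu> (onb i) h)"
    by (rule cov_gs_proj_left[OF assms assms])
  also have "\<dots> = var_nu \<nu> h - (\<Sum>i<n. (cov_nu \<nu> h (onb i))\<^sup>2)"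
    unfolding var_nu_def power2_eq_square by (metis cov_sym)
  finally show ?thesis
    by (simp add: resid_var_eq_gs_proj assms)
qed

lemma resid_var_nonneg: "h \<in> blip0 \<nu> \<Longrightarrow> 0 \<le> resid_var_nu \<nu> h u n"
  by (simp add: resid_var_eq_gs_proj var_nonneg gs_proj_blip0)

lemma resid_var_le_var: "h \<in> blip0 \<nu> \<Longrightarrow> resid_var_nu \<nu> h u n \<le> var_nu \<nu> h"
  by (simp add: resid_var_eq sum_nonneg)

text \<open>If the residual variance were 0, the residual itself would vanish almost everywhere,
  which exhibits \<open>h\<close> as a combination of the first n functions.\<close>

lemma resid_var_pos:
  assumes "h \<in> blip0 \<nu>"
    and nd: "\<not> (\<exists>lam::nat \<Rightarrow> real. AE x in \<nu>. h x = (\<Sum>i<n. lam i * u i x))"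
  shows "0 < resid_var_nu \<nu> h u n"
proof (rule ccontr)
  assume "\<not> ?thesis"
  then have "var_nu \<nu> (gs_resid h n) = 0"
    using resid_var_nonneg[OF assms(1), of n] by (simp add: resid_var_eq_gs_proj assms)
  then have "AE x in \<nu>. gs_resid h n x = 0"
    by (rule var_eq_0_imp_AE[OF gs_proj_blip0[OF assms(1)]])
  moreover obtain lam where "(\<lambda>x. h x - gs_resid h n x) = (\<lambda>x. \<Sum>i<n. lam i * u i x)"
    using gs_proj_diff_comb[of h n] by (auto simp: comb_def)
  then have "\<And>x. h x = gs_resid h n x + (\<Sum>i<n. lam i * u i x)"
    by (metis add.commute diff_add_cancel)
  ultimately have "AE x in \<nu>. h x = (\<Sum>i<n. lam i * u i x)"
    by (auto elim!: eventually_mono)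
  then show False
    using nd by blast
qed

text \<open>With positive residual variances each normalization can be undone: \<open>u i\<close> is
  its residual, a multiple of \<open>onb i\<close>, plus earlier vectors.\<close>

lemma comb_gs_eq:
  assumes "\<And>i. i < n \<Longrightarrow> 0 < resid_var_nu \<nu> (u i) u i"
  shows "comb u n = comb onb n"
proof
  show "comb u n \<subseteq> comb onb n"
  proof (rule comb_subset)
    fix i assume i: "i < n"
    have e: "onb j \<in> comb onb n" if "j \<le> i" for j
      using that i by (intro comb_base) auto
    have nz: "var_nu \<nu> (gs_resid (u i) i) \<noteq> 0"
      using assms[OF i] by (simp add: resid_var_eq_gs_proj u)
    have "(\<lambda>x. sqrt (var_nu \<nu> (gs_resid (u i) i)) * onb i x) \<in> comb onb n"
      by (intro comb_scale e) simp
    then have "gs_resid (u i) i \<in> comb onb n"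
      by (simp add: gs_proj_eq[OF nz, symmetric])
    then have "(\<lambda>x. gs_resid (u i) i x + (\<Sum>j<i. cov_nu \<nu> (u i) (onb j) * onb j x)) \<in> comb onb n"
      by (intro comb_add comb_sum e) auto
    then show "u i \<in> comb onb n"
      by (simp add: gs_proj_def)
  qed
qed (rule comb_gs_subset)

lemma gs_sqnorm_eq_1: "0 < resid_var_nu \<nu> (u i) u i \<Longrightarrow> gs_sqnorm i = 1"
  by (simp add: gs_sqnorm_def resid_var_eq_gs_proj u)

lemma var_diff_gs_comb:
  assumes "h \<in> blip0 \<nu>"
  shows "var_nu \<nu> (\<lambda>x. h x - (\<Sum>i<n. a i * onb i x))
    = resid_var_nu \<nu> h u n + (\<Sum>i<n. gs_sqnorm i * (cov_nu \<nu> h (onb i) - a i)\<^sup>2)"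
proof -
  let ?v = "\<lambda>x. \<Sum>i<n. a i * onb i x" and ?d = "\<lambda>i. cov_nu \<nu> h (onb i) - a i"
  have "?v \<in> comb u n"
    using comb_gs_subset combI by blast
  then have "var_nu \<nu> (\<lambda>x. h x - ?v x) = var_nu \<nu> (gs_resid h n) + var_nu \<nu> (\<lambda>x. h x - gs_resid h n x - ?v x)"
    by (rule var_diff_comb[OF assms])
  also have "(\<lambda>x. h x - gs_resid h n x - ?v x) = (\<lambda>x. \<Sum>i<n. ?d i * onb i x)"
    by (simp add: gs_proj_def left_diff_distrib sum_subtractf)
  also have "var_nu \<nu> \<dots> = (\<Sum>i<n. \<Sum>j<n. ?d i * ?d j * (if i = j then gs_sqnorm i else 0))"
    unfolding var_nu_def by (subst cov_sum) (simp_all add: gs_blip0 cov_gs)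
  also have "\<dots> = (\<Sum>i<n. \<Sum>j<n. if i = j then gs_sqnorm i * (?d i)\<^sup>2 else 0)"
    by (intro sum.cong) (auto simp: power2_eq_square)
  also have "\<dots> = (\<Sum>i<n. gs_sqnorm i * (?d i)\<^sup>2)"
    by simp
  finally show ?thesis
    by (simp add: resid_var_eq_gs_proj assms)
qed

end
end

subsection \<open>Deviation of empirical covariances\<close>

text \<open>By Kantorovich-Rubinstein duality, the Wasserstein-1 distance between \<nu> and the
  empirical measure of the first m points. The real supremum is meaningful once the set is bounded,
  which \<open>bdd_above_emp_dev\<close> provides.\<close>

definition emp_dev :: "'a::metric_space measure \<Rightarrow> (nat \<Rightarrow> 'a) \<Rightarrow> nat \<Rightarrow> real" where
  "emp_dev \<nu> z m = (SUP h\<in>{h. 1-lipschitz_on UNIV h}. \<bar>(\<integral>x. h x \<partial>\<nu>) - emp_mean z m h\<bar>)"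

lemma lipschitz_on_lip_const:
  assumes "\<exists>L. L-lipschitz_on UNIV h"
  shows "(lip_const h)-lipschitz_on UNIV (h :: 'a::metric_space \<Rightarrow> real)"
proof (rule lipschitz_onI)
  show "0 \<le> lip_const h"
    unfolding lip_const_def using assms by (intro cInf_greatest) (auto intro: lipschitz_on_nonneg)
  fix x y
  show "dist (h x) (h y) \<le> lip_const h * dist x y"
  proof (cases "x = y")
    case False
    have "dist (h x) (h y) / dist x y \<le> lip_const h"
      unfolding lip_const_def using assms False
      by (intro cInf_greatest) (auto simp: divide_le_eq dest: lipschitz_onD)
    then show ?thesis
      using False by (simp add: divide_le_eq)
  qed simp
qed

lemma abs_le_linf_norm:
  assumes "bounded (range h)"
  shows "\<bar>h x\<bar> \<le> linf_norm h"
proof -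
  obtain B where "\<And>x. \<bar>h x\<bar> \<le> B"
    using assms by (auto simp: bounded_iff)
  then show ?thesis
    unfolding linf_norm_def by (intro cSUP_upper bdd_aboveI2) auto
qed

lemma emp_mean_scale: "emp_mean z m (\<lambda>x. a * h x) = a * emp_mean z m h"
  by (simp add: emp_mean_def sum_distrib_left)

lemma abs_emp_mean_le:
  assumes "m \<ge> 1" "\<And>x. \<bar>h x\<bar> \<le> B"
  shows "\<bar>emp_mean z m h\<bar> \<le> B"
proof -
  have "\<bar>\<Sum>k<m. h (z k)\<bar> \<le> (\<Sum>k<m. B)"
    by (rule order_trans[OF sum_abs sum_mono[OF assms(2)]])
  then show ?thesis
    using assms(1) by (simp add: emp_mean_def field_simps)
qed

text \<open>The form is at most \<eta> times the square of the sum of the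
  \<open>\<bar>c i\<bar>\<close>; Cauchy-Schwarz against the constant 1 then costs the factor
  N.\<close>

lemma quadratic_form_bound:
  fixes c :: "nat \<Rightarrow> real"
  assumes "\<And>i j. i < N \<Longrightarrow> j < N \<Longrightarrow> \<bar>d i j\<bar> \<le> \<eta>"
  shows "\<bar>\<Sum>i<N. \<Sum>j<N. c i * c j * d i j\<bar> \<le> \<eta> * (real N * (\<Sum>i<N. (c i)\<^sup>2))"
proof (cases "N = 0")
  case False
  have \<eta>: "0 \<le> \<eta>"
    using assms[of 0 0] False by auto
  have "\<bar>\<Sum>i<N. \<Sum>j<N. c i * c j * d i j\<bar> \<le> (\<Sum>i<N. \<Sum>j<N. \<bar>c i\<bar> * \<bar>c j\<bar> * \<eta>)"
    by (intro order_trans[OF sum_abs] sum_mono order_trans[OF sum_abs])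
       (auto simp: abs_mult intro!: mult_left_mono assms)
  also have "\<dots> = \<eta> * (\<Sum>i<N. \<bar>c i\<bar>)\<^sup>2"
    by (simp add: power2_eq_square sum_product sum_distrib_left sum_distrib_right mult_ac)
  also have "(\<Sum>i<N. \<bar>c i\<bar>)\<^sup>2 \<le> real N * (\<Sum>i<N. (c i)\<^sup>2)"
    using Cauchy_Schwarz_ineq_sum[of "\<lambda>_. 1" "\<lambda>i. \<bar>c i\<bar>" "{..<N}"] by simp
  finally show ?thesis
    using \<eta> by (simp add: mult_left_mono)
qed simp

context borel_prob_space
begin

lemma integrable_lipschitz:
  assumes "integrable \<nu> (norm :: 'a \<Rightarrow> real)" "L-lipschitz_on UNIV (h :: 'a \<Rightarrow> real)"
  shows "integrable \<nu> h"
proof (rule Bochner_Integration.integrable_bound)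
  show "integrable \<nu> (\<lambda>x. \<bar>h 0\<bar> + L * norm x)"
    using assms(1) by (intro Bochner_Integration.integrable_add integrable_mult_right) auto
  show "h \<in> borel_measurable \<nu>"
    using borel_measurable_continuous_onI[OF lipschitz_on_continuous_on[OF assms(2)]]
    by (simp add: measurable_cong_sets[OF sets_borel refl])
  have "\<bar>h x\<bar> \<le> \<bar>h 0\<bar> + L * norm x" for x
    using lipschitz_onD[OF assms(2), of x 0] by (simp add: dist_real_def)
  then show "AE x in \<nu>. norm (h x) \<le> norm (\<bar>h 0\<bar> + L * norm x)"
    by (auto intro: order_trans[OF _ abs_ge_self])
qed

text \<open>After subtraction of \<open>h 0\<close>, a 1-Lipschitz function is dominated by the
  norm. The bound is the same for all \<open>h\<close>, so the supremum is finite.\<close>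

lemma emp_dev_aux:
  assumes int: "integrable \<nu> (norm :: 'a \<Rightarrow> real)" and m: "m \<ge> 1"
    and h: "1-lipschitz_on UNIV (h :: 'a \<Rightarrow> real)"
  shows "\<bar>(\<integral>x. h x \<partial>\<nu>) - emp_mean z m h\<bar> \<le> (\<integral>x. norm x \<partial>\<nu>) + emp_mean z m norm"
proof -
  have hi: "integrable \<nu> h"
    by (rule integrable_lipschitz[OF int h])
  have b: "\<bar>h x - h 0\<bar> \<le> norm x" for x
    using lipschitz_onD[OF h, of x 0] by (simp add: dist_real_def)
  have "\<bar>(\<integral>x. h x \<partial>\<nu>) - h 0\<bar> = \<bar>\<integral>x. h x - h 0 \<partial>\<nu>\<bar>"
    using hi by (simp add: prob_space)
  also have "\<dots> \<le> (\<integral>x. norm x \<partial>\<nu>)"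
    using hi int b by (intro integral_abs_bound[THEN order_trans] integral_mono) auto
  finally have 1: "\<bar>(\<integral>x. h x \<partial>\<nu>) - h 0\<bar> \<le> (\<integral>x. norm x \<partial>\<nu>)" .
  have "emp_mean z m h - h 0 = (\<Sum>k<m. h (z k) - h 0) / real m"
    using m by (simp add: emp_mean_def sum_subtractf diff_divide_distrib)
  also have "\<bar>\<dots>\<bar> \<le> emp_mean z m norm"
    using m unfolding emp_mean_def
    by (auto simp: abs_divide intro!: divide_right_mono order_trans[OF sum_abs] sum_mono b)
  finally show ?thesis
    using 1 by linarith
qed

lemma bdd_above_emp_dev:
  assumes "integrable \<nu> (norm :: 'a \<Rightarrow> real)" "m \<ge> 1"
  shows "bdd_above ((\<lambda>h. \<bar>(\<integral>x. h x \<partial>\<nu>) - emp_mean z m h\<bar>) ` {h :: 'a \<Rightarrow> real. 1-lipschitz_on UNIV h})"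
  using emp_dev_aux[OF assms] by (intro bdd_aboveI2) auto

lemma emp_dev_lipschitz:
  assumes int: "integrable \<nu> (norm :: 'a \<Rightarrow> real)" and m: "m \<ge> 1"
    and h: "L-lipschitz_on UNIV (h :: 'a \<Rightarrow> real)"
  shows "\<bar>(\<integral>x. h x \<partial>\<nu>) - emp_mean z m h\<bar> \<le> L * emp_dev \<nu> z m"
\<comment> \<open>Division by L is impossible here, but \<open>h\<close> is then constant and both
  means agree; \<open>1 \<le> m\<close> makes the empirical mean of a constant equal to it.\<close>
proof (cases "L = 0")
  case True
  then have "h = (\<lambda>_. h 0)"
    using lipschitz_onD[OF h] by (auto simp: fun_eq_iff)
  then obtain c where "h = (\<lambda>_. c)"
    by metis
  then show ?thesis
    using True m by (simp add: emp_mean_def prob_space)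
next
  case False
  then have L: "L > 0"
    using lipschitz_on_nonneg[OF h] by simp
  let ?k = "\<lambda>x. (1 / L) * h x"
  have "(\<bar>1 / L\<bar> * L)-lipschitz_on UNIV ?k"
    by (rule lipschitz_on_cmult_real[OF h])
  then have "1-lipschitz_on UNIV ?k"
    using L by simp
  then have "\<bar>(\<integral>x. ?k x \<partial>\<nu>) - emp_mean z m ?k\<bar> \<le> emp_dev \<nu> z m"
    unfolding emp_dev_def by (intro cSUP_upper bdd_above_emp_dev int m) simp
  moreover have "(\<integral>x. ?k x \<partial>\<nu>) - emp_mean z m ?k = ((\<integral>x. h x \<partial>\<nu>) - emp_mean z m h) / L"
    by (simp only: emp_mean_scale integral_mult_right_zero) (simp add: diff_divide_distrib)
  ultimately show ?thesis
    using L by (simp add: abs_divide field_simps)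
qed

lemma emp_cov_deviation:
  assumes int: "integrable \<nu> (norm :: 'a \<Rightarrow> real)" and m: "m \<ge> 1"
    and hk: "h \<in> blip0 \<nu>" "k \<in> blip0 \<nu>"
    and lip: "L-lipschitz_on UNIV h" "L-lipschitz_on UNIV k"
    and bd: "\<And>x. \<bar>h x\<bar> \<le> K" "\<And>x. \<bar>k x\<bar> \<le> K"
    and \<kappa>: "emp_dev \<nu> z m \<le> \<kappa>"
  shows "\<bar>cov_nu \<nu> h k - emp_cov z m h k\<bar> \<le> 3 * K * L * \<kappa>"
proof -
  have K: "0 \<le> K"
    using bd(1)[of undefined] by linarith
  have L: "0 \<le> L"
    by (rule lipschitz_on_nonneg[OF lip(1)])
  have "(2 * K * L)-lipschitz_on UNIV (\<lambda>x. h x * k x)"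
  proof (rule lipschitz_onI)
    fix x y
    have hd: "\<bar>h x - h y\<bar> \<le> L * dist x y" "\<bar>k x - k y\<bar> \<le> L * dist x y"
      using lipschitz_onD[OF lip(1), of x y] lipschitz_onD[OF lip(2), of x y] by (auto simp: dist_real_def)
    have "h x * k x - h y * k y = h x * (k x - k y) + (h x - h y) * k y"
      by (simp add: algebra_simps)
    then have "\<bar>h x * k x - h y * k y\<bar> \<le> \<bar>h x\<bar> * \<bar>k x - k y\<bar> + \<bar>h x - h y\<bar> * \<bar>k y\<bar>"
      by (metis abs_mult abs_triangle_ineq)
    also have "\<dots> \<le> K * (L * dist x y) + (L * dist x y) * K"
      using hd bd K L by (intro add_mono mult_mono) auto
    finally show "dist (h x * k x) (h y * k y) \<le> 2 * K * L * dist x y"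
      by (simp add: dist_real_def algebra_simps)
  qed (use K L in auto)
  then have 1: "\<bar>(\<integral>x. h x * k x \<partial>\<nu>) - emp_mean z m (\<lambda>x. h x * k x)\<bar> \<le> 2 * K * L * emp_dev \<nu> z m"
    by (rule emp_dev_lipschitz[OF int m])
  have 2: "\<bar>emp_mean z m h\<bar> \<le> L * emp_dev \<nu> z m"
    using emp_dev_lipschitz[OF int m lip(1), of z] hk(1) by (simp add: blip0_def)
  have 3: "\<bar>emp_mean z m k\<bar> \<le> K"
    by (rule abs_emp_mean_le[OF m bd(2)])
  have "\<bar>emp_mean z m h * emp_mean z m k\<bar> \<le> (L * emp_dev \<nu> z m) * K"
    unfolding abs_mult using 2 3 by (intro mult_mono order_trans[OF _ 2]) auto
  then have "\<bar>cov_nu \<nu> h k - emp_cov z m h k\<bar> \<le> 3 * K * L * emp_dev \<nu> z m"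
    using 1 hk unfolding cov_blip0[OF hk(1)] emp_cov_def by (simp add: mult_ac)
  also have "\<dots> \<le> 3 * K * L * \<kappa>"
    using K L \<kappa> by (intro mult_left_mono) auto
  finally show ?thesis .
qed

lemma emp_var_deviation:
  assumes v: "\<And>i. i < n \<Longrightarrow> v i \<in> blip0 \<nu>" "h \<in> blip0 \<nu>"
    and d: "\<And>k l. k \<in> insert h (v ` {..<n}) \<Longrightarrow> l \<in> insert h (v ` {..<n}) \<Longrightarrow>
      \<bar>cov_nu \<nu> k l - emp_cov z m k l\<bar> \<le> \<eta>"
  shows "\<bar>var_nu \<nu> (\<lambda>x. h x - (\<Sum>i<n. a i * v i x)) - emp_var z m (\<lambda>x. h x - (\<Sum>i<n. a i * v i x))\<bar>
    \<le> \<eta> * (real (Suc n) * (1 + (\<Sum>i<n. (a i)\<^sup>2)))"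
proof -
  \<comment> \<open>The function \<open>h\<close> is appended at index n with coefficient 1, so that
    the residual is one quadratic form in \<open>Suc n\<close> functions; this is the origin of both
    \<open>Suc n\<close> and the summand 1 in the bound.\<close>
  let ?w = "\<lambda>i. if i < n then v i else h"
  let ?c = "\<lambda>i. if i < n then - a i else 1"
  have eq: "(\<lambda>x. h x - (\<Sum>i<n. a i * v i x)) = (\<lambda>x. \<Sum>i<Suc n. ?c i * ?w i x)"
    by (simp add: sum_negf)
  have w: "?w i \<in> blip0 \<nu>" for i
    using v by simp
  have mem: "?w i \<in> insert h (v ` {..<n})" for i
    by simp
  have diff: "var_nu \<nu> (\<lambda>x. \<Sum>i<Suc n. ?c i * ?w i x) - emp_var z m (\<lambda>x. \<Sum>i<Suc n. ?c i * ?w i x)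
      = (\<Sum>i<Suc n. \<Sum>j<Suc n. ?c i * ?c j * (cov_nu \<nu> (?w i) (?w j) - emp_cov z m (?w i) (?w j)))"
    unfolding var_nu_def emp_var_eq_emp_cov cov_sum[OF w w] emp_cov_sum
    by (simp only: right_diff_distrib sum_subtractf)
  have bound: "\<bar>\<Sum>i<Suc n. \<Sum>j<Suc n. ?c i * ?c j * (cov_nu \<nu> (?w i) (?w j) - emp_cov z m (?w i) (?w j))\<bar>
      \<le> \<eta> * (real (Suc n) * (\<Sum>i<Suc n. (?c i)\<^sup>2))"
    by (rule quadratic_form_bound) (rule d[OF mem mem])
  have sq: "(\<Sum>i<Suc n. (?c i)\<^sup>2) = 1 + (\<Sum>i<n. (a i)\<^sup>2)"
    by simp
  show ?thesis
    unfolding eq using bound unfolding diff sq .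
qed

text \<open>
  The residual with coefficients \<open>a\<close> exceeds the optimal one by the squared distance of \<open>a\<close> to the
  optimal coefficients, which absorbs the deviation of the empirical variance for large \<open>a\<close>: no empirical minimizer has to be controlled.
\<close>

lemma resid_var_deviation:
  assumes u: "\<And>i. u i \<in> blip0 \<nu>" and h: "h \<in> blip0 \<nu>" "h' \<in> blip0 \<nu>"
    and nd: "\<And>i. i < n \<Longrightarrow> 0 < resid_var_nu \<nu> (u i) u i"
    and d: "\<And>f k l. f \<in> {h, h'} \<Longrightarrow> k \<in> insert f (gs (cov_nu \<nu>) u ` {..<n}) \<Longrightarrow>
      l \<in> insert f (gs (cov_nu \<nu>) u ` {..<n}) \<Longrightarrow> \<bar>cov_nu \<nu> k l - emp_cov z m k l\<bar> \<le> \<eta>"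
    and small: "2 * \<eta> * real (Suc n) \<le> 1"
    and K2: "var_nu \<nu> h \<le> K2" "var_nu \<nu> h' \<le> K2"
    and le: "emp_resid_var z m h' u n \<le> emp_resid_var z m h u n"
  shows "resid_var_nu \<nu> h' u n - \<eta> * real (Suc n) * (2 + 3 * K2) \<le> resid_var_nu \<nu> h u n"
proof -
  define e where "e = gs (cov_nu \<nu>) u"
  have e: "e i \<in> blip0 \<nu>" for i
    unfolding e_def by (rule gs_blip0[OF u])
  have comb: "comb u n = comb e n"
    unfolding e_def by (rule comb_gs_eq[OF u nd])
  have gs_sqnorm: "i < n \<Longrightarrow> gs_sqnorm u i = 1" for i
    by (rule gs_sqnorm_eq_1[OF u nd])
  have \<eta>: "0 \<le> \<eta>"
    using d[of h h h] by auto
  let ?q = "\<eta> * real (Suc n)"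
  \<comment> \<open>The bound 1/2 is what lets the term with \<open>2 * ?q\<close> below be absorbed
    by the Pythagorean excess.\<close>
  have q: "0 \<le> ?q" "?q \<le> 1 / 2"
    using \<eta> small by auto
  have Pyth: "var_nu \<nu> (\<lambda>x. f x - (\<Sum>i<n. a i * e i x))
      = resid_var_nu \<nu> f u n + (\<Sum>i<n. (cov_nu \<nu> f (e i) - a i)\<^sup>2)" if "f \<in> blip0 \<nu>" for f a
    using var_diff_gs_comb[OF u that, where n = n and a = a] by (simp add: e_def gs_sqnorm)
  have dev: "\<bar>var_nu \<nu> (\<lambda>x. f x - (\<Sum>i<n. a i * e i x)) - emp_var z m (\<lambda>x. f x - (\<Sum>i<n. a i * e i x))\<bar>
      \<le> ?q * (1 + (\<Sum>i<n. (a i)\<^sup>2))" if "f \<in> {h, h'}" for f a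
    using emp_var_deviation[where n = n and v = e and h = f and z = z and m = m and \<eta> = \<eta> and a = a]
      e h that d[OF that] by (auto simp: e_def mult.assoc)
  have coef: "(\<Sum>i<n. (cov_nu \<nu> f (e i))\<^sup>2) \<le> K2" if "f \<in> {h, h'}" for f
    using resid_var_eq[where u = u and h = f and n = n, OF u]
      resid_var_nonneg[where u = u and h = f and n = n, OF u] h K2 that by (auto simp: e_def)
  \<comment> \<open>For the upper bound a single competitor suffices: the coefficients that are
    optimal under \<nu>, whose squares sum to at most \<open>K2\<close>.\<close>
  have "emp_resid_var z m h u n \<le> emp_var z m (\<lambda>x. h x - (\<Sum>i<n. cov_nu \<nu> h (e i) * e i x))"
    unfolding emp_resid_var_comb comb
    by (intro cINF_lower combI bdd_belowI2[where m = 0] emp_var_nonneg)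
  also have "\<dots> \<le> resid_var_nu \<nu> h u n + ?q * (1 + (\<Sum>i<n. (cov_nu \<nu> h (e i))\<^sup>2))"
    using dev[of h "\<lambda>i. cov_nu \<nu> h (e i)"] Pyth[OF h(1), of "\<lambda>i. cov_nu \<nu> h (e i)"] by simp
  also have "\<dots> \<le> resid_var_nu \<nu> h u n + ?q * (1 + K2)"
    using coef[of h] q by (intro add_left_mono mult_left_mono) auto
  finally have up: "emp_resid_var z m h u n \<le> resid_var_nu \<nu> h u n + ?q * (1 + K2)" .
  have "resid_var_nu \<nu> h' u n - ?q * (1 + 2 * K2) \<le> emp_resid_var z m h' u n"
    unfolding emp_resid_var_comb comb
  proof (rule cINF_greatest)
    fix v assume "v \<in> comb e n"
    then obtain a where v: "v = (\<lambda>x. \<Sum>i<n. a i * e i x)"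
      by (auto simp: comb_def)
    let ?S = "\<Sum>i<n. (cov_nu \<nu> h' (e i) - a i)\<^sup>2"
    \<comment> \<open>With c for the optimal coefficient, the difference of the two sides is the
      square of 2c - a.\<close>
    have "(a i)\<^sup>2 \<le> 2 * (cov_nu \<nu> h' (e i) - a i)\<^sup>2 + 2 * (cov_nu \<nu> h' (e i))\<^sup>2" for i
      using zero_le_power2[of "2 * cov_nu \<nu> h' (e i) - a i"] by (simp add: power2_eq_square algebra_simps)
    then have "(\<Sum>i<n. (a i)\<^sup>2) \<le> 2 * ?S + 2 * (\<Sum>i<n. (cov_nu \<nu> h' (e i))\<^sup>2)"
      by (simp add: sum_distrib_left sum.distrib[symmetric] sum_mono)
    also have "\<dots> \<le> 2 * ?S + 2 * K2"
      using coef[of h'] by simp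
    finally have "?q * (1 + (\<Sum>i<n. (a i)\<^sup>2)) \<le> ?q * (1 + (2 * ?S + 2 * K2))"
      using q by (intro mult_left_mono) auto
    also have "\<dots> = ?q * (1 + 2 * K2) + (2 * ?q) * ?S"
      by (simp add: algebra_simps)
    also have "(2 * ?q) * ?S \<le> 1 * ?S"
      using q by (intro mult_right_mono) (auto simp: sum_nonneg)
    finally have "?q * (1 + (\<Sum>i<n. (a i)\<^sup>2)) \<le> ?q * (1 + 2 * K2) + ?S"
      by simp
    then show "resid_var_nu \<nu> h' u n - ?q * (1 + 2 * K2) \<le> emp_var z m (\<lambda>x. h' x - v x)"
      using dev[of h' a] Pyth[OF h(2), of a] unfolding v by auto
  qed (use comb_zero in blast)
  \<comment> \<open>The two error terms, with \<open>1 + K2\<close> and \<open>1 + 2 * K2\<close>,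
    add up to \<open>2 + 3 * K2\<close>. Here \<open>K2\<close> bounds variances, so it is the
    square of the constant of the theorem.\<close>
  then show ?thesis
    using up le by (simp add: algebra_simps)
qed

lemma resid_var_0: "resid_var_nu \<nu> h u 0 = var_nu \<nu> h"
  by (simp add: resid_var_nu_def)

lemma emp_resid_var_0: "emp_resid_var z m h u 0 = emp_var z m h"
  by (simp add: emp_resid_var_def)

end

subsection \<open>Measurability of residual variances\<close>

text \<open>Measurable in the outcome and continuous in the point (a Caratheodory function) implies
  jointly measurable: the point is replaced by simple functions \<open>F i\<close> tending to the
  identity. The selected functions are only assumed measurable at each point, whereas their
  covariances integrate over the point.\<close>

lemma borel_measurable_pair_continuous:
  fixes h :: "'w \<Rightarrow> 'a::{second_countable_topology, metric_space} \<Rightarrow> real"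
  assumes meas: "\<And>x. (\<lambda>\<omega>. h \<omega> x) \<in> borel_measurable N"
    and cont: "\<And>\<omega>. \<omega> \<in> space N \<Longrightarrow> continuous_on UNIV (h \<omega>)"
    and B [measurable_cong]: "sets B = sets borel"
  shows "(\<lambda>p. h (fst p) (snd p)) \<in> borel_measurable (N \<Otimes>\<^sub>M B)"
proof -
  have "(\<lambda>x. x) \<in> borel_measurable (borel :: 'a measure)"
    by simp
  from borel_measurable_implies_sequence_metric[OF this, of undefined]
  obtain F where F: "\<And>i. simple_function (borel :: 'a measure) (F i)" "\<And>x :: 'a. (\<lambda>i. F i x) \<longlonglongrightarrow> x"
    by auto
  have fin: "finite (range (F i))" for i
    using F(1)[of i] by (simp add: simple_function_def)
  have [measurable]: "F i \<in> borel_measurable borel" for i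
    using borel_measurable_simple_function[OF F(1)] .
  show ?thesis
  proof (rule borel_measurable_LIMSEQ_real)
    fix p assume "p \<in> space (N \<Otimes>\<^sub>M B)"
    then have "isCont (h (fst p)) (snd p)"
      using cont by (auto simp: space_pair_measure continuous_on_eq_continuous_at)
    then show "(\<lambda>i. h (fst p) (F i (snd p))) \<longlonglongrightarrow> h (fst p) (snd p)"
      using F(2) by (rule isCont_tendsto_compose)
  next
    fix i
    have [measurable]: "F i -` {y} \<in> sets borel" for y
      using measurable_sets[of "F i" borel borel "{y}"] by simp
    have [measurable]: "(\<lambda>\<omega>. h \<omega> y) \<in> borel_measurable N" for y
      by (rule meas)
    \<comment> \<open>Since \<open>F i\<close> has finitely many values, only finitely many of the
      sections with fixed point occur.\<close>
    have "(\<lambda>p. h (fst p) (F i (snd p))) = (\<lambda>p. \<Sum>y\<in>range (F i). indicator (F i -` {y}) (snd p) * h (fst p) y)"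
    proof
      fix p :: "'w \<times> 'a"
      have "(\<Sum>y\<in>range (F i). indicator (F i -` {y}) (snd p) * h (fst p) y)
          = (\<Sum>y\<in>range (F i). if y = F i (snd p) then h (fst p) y else 0)"
        by (intro sum.cong) (auto simp: indicator_def)
      then show "h (fst p) (F i (snd p)) = (\<Sum>y\<in>range (F i). indicator (F i -` {y}) (snd p) * h (fst p) y)"
        using fin[of i] by simp
    qed
    also have "\<dots> \<in> borel_measurable (N \<Otimes>\<^sub>M B)"
      by measurable
    finally show "(\<lambda>p. h (fst p) (F i (snd p))) \<in> borel_measurable (N \<Otimes>\<^sub>M B)" .
  qed
qed

context borel_prob_space
begin

lemma cov_measurable:
  assumes [measurable]: "(\<lambda>p. H (fst p) (snd p)) \<in> borel_measurable (N \<Otimes>\<^sub>M \<nu>)"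
    "(\<lambda>p. K (fst p) (snd p)) \<in> borel_measurable (N \<Otimes>\<^sub>M \<nu>)"
  shows "(\<lambda>\<omega>. cov_nu \<nu> (H \<omega>) (K \<omega>)) \<in> borel_measurable N"
proof -
  have 1: "case_prod (\<lambda>\<omega> x. H \<omega> x * K \<omega> x) \<in> borel_measurable (N \<Otimes>\<^sub>M \<nu>)"
    "case_prod H \<in> borel_measurable (N \<Otimes>\<^sub>M \<nu>)" "case_prod K \<in> borel_measurable (N \<Otimes>\<^sub>M \<nu>)"
    by (simp_all add: case_prod_unfold)
  show ?thesis
    unfolding cov_nu_def
    by (intro borel_measurable_diff borel_measurable_times borel_measurable_lebesgue_integral 1)
qed

lemma gs_measurable:
  assumes "\<And>i. i < n \<Longrightarrow> (\<lambda>p. U (fst p) i (snd p)) \<in> borel_measurable (N \<Otimes>\<^sub>M \<nu>)"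
    and "i < n"
  shows "(\<lambda>p. gs (cov_nu \<nu>) (U (fst p)) i (snd p)) \<in> borel_measurable (N \<Otimes>\<^sub>M \<nu>)"
  using \<open>i < n\<close>
proof (induction i rule: less_induct)
  case (less i)
  let ?w = "\<lambda>\<omega>. gs_proj (cov_nu \<nu>) (U \<omega>) (U \<omega> i) i"
  have e [measurable]: "(\<lambda>p. gs (cov_nu \<nu>) (U (fst p)) j (snd p)) \<in> borel_measurable (N \<Otimes>\<^sub>M \<nu>)" if "j < i" for j
    using less that by simp
  have u [measurable]: "(\<lambda>p. U (fst p) i (snd p)) \<in> borel_measurable (N \<Otimes>\<^sub>M \<nu>)"
    using assms less.prems by simp
  have "(\<lambda>\<omega>. cov_nu \<nu> (U \<omega> i) (gs (cov_nu \<nu>) (U \<omega>) j)) \<in> borel_measurable N" if "j < i" for j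
    by (rule cov_measurable[OF u e[OF that]])
  then have w [measurable]: "(\<lambda>p. ?w (fst p) (snd p)) \<in> borel_measurable (N \<Otimes>\<^sub>M \<nu>)"
    unfolding gs_proj_def
    by (intro borel_measurable_diff u borel_measurable_sum borel_measurable_times e
        measurable_compose[OF measurable_fst]) auto
  have [measurable]: "(\<lambda>\<omega>. cov_nu \<nu> (?w \<omega>) (?w \<omega>)) \<in> borel_measurable N"
    by (rule cov_measurable[OF w w])
  have "(\<lambda>p. ?w (fst p) (snd p) / sqrt (cov_nu \<nu> (?w (fst p)) (?w (fst p)))) \<in> borel_measurable (N \<Otimes>\<^sub>M \<nu>)"
    by measurable
  then show ?case
    by (subst gs_rec)
qed

text \<open>The closed formula replaces the infimum over all coefficients by finitely many
  covariances. It also holds for degenerate \<open>U \<omega>\<close>, hence at every outcome and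
  without an exceptional set.\<close>

lemma resid_var_measurable:
  assumes U: "\<And>i. i < n \<Longrightarrow> (\<lambda>p. U (fst p) i (snd p)) \<in> borel_measurable (N \<Otimes>\<^sub>M \<nu>)"
    and H: "(\<lambda>p. H (fst p) (snd p)) \<in> borel_measurable (N \<Otimes>\<^sub>M \<nu>)"
    and blip: "\<And>\<omega> i. \<omega> \<in> space N \<Longrightarrow> U \<omega> i \<in> blip0 \<nu>" "\<And>\<omega>. \<omega> \<in> space N \<Longrightarrow> H \<omega> \<in> blip0 \<nu>"
  shows "(\<lambda>\<omega>. resid_var_nu \<nu> (H \<omega>) (U \<omega>) n) \<in> borel_measurable N"
proof -
  have "(\<lambda>\<omega>. var_nu \<nu> (H \<omega>) - (\<Sum>i<n. (cov_nu \<nu> (H \<omega>) (gs (cov_nu \<nu>) (U \<omega>) i))\<^sup>2)) \<in> borel_measurable N"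
    unfolding var_nu_def
    by (intro borel_measurable_diff borel_measurable_sum borel_measurable_power cov_measurable H gs_measurable U) auto
  then show ?thesis
    by (rule measurable_cong[THEN iffD1, rotated]) (rule resid_var_eq[OF blip(1) blip(2), symmetric])
qed

section \<open>The L2 distance, separability of the family and measurability of the supremum\<close>

lemma cov_le_sqrt_var:
  assumes "h \<in> blip0 \<nu>" "k \<in> blip0 \<nu>"
  shows "cov_nu \<nu> h k \<le> sqrt (var_nu \<nu> h) * sqrt (var_nu \<nu> k)"
proof (cases "var_nu \<nu> k = 0")
  case True
  then show ?thesis
    using cov_eq_0_if_var_0[OF assms(2)] by simp
next
  case False
  then have pos: "var_nu \<nu> k > 0"
    using var_nonneg[OF assms(2)] by simp
  define t where "t = cov_nu \<nu> h k / var_nu \<nu> k"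
  let ?r = "\<lambda>x. h x - t * k x"
  have tk: "(\<lambda>x. t * k x) \<in> blip0 \<nu>"
    by (rule blip0_scale[OF assms(2)])
  have r: "?r \<in> blip0 \<nu>"
    by (rule blip0_diff[OF assms(1) tk])
  have "cov_nu \<nu> ?r k = 0"
    unfolding cov_diff_left[OF assms(1) tk assms(2)] cov_scale_left[OF assms(2)]
    using pos by (simp add: t_def var_nu_def)
  then have orth: "cov_nu \<nu> ?r (\<lambda>x. t * k x) = 0"
    by (metis cov_scale_left[OF assms(2)] cov_sym mult_zero_right)
  have "var_nu \<nu> (\<lambda>x. ?r x + t * k x) = var_nu \<nu> ?r + var_nu \<nu> (\<lambda>x. t * k x)"
    by (rule var_add_orth[OF r tk orth])
  also have "var_nu \<nu> (\<lambda>x. t * k x) = t\<^sup>2 * var_nu \<nu> k"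
    unfolding var_nu_def cov_scale_left[OF assms(2)] cov_sym[of k "\<lambda>x. t * k x"]
    by (simp add: power2_eq_square)
  finally have "t\<^sup>2 * var_nu \<nu> k \<le> var_nu \<nu> h"
    using var_nonneg[OF r] by simp
  then have "(cov_nu \<nu> h k)\<^sup>2 \<le> var_nu \<nu> h * var_nu \<nu> k"
    using pos by (simp add: t_def power2_eq_square field_simps)
  then have "sqrt ((cov_nu \<nu> h k)\<^sup>2) \<le> sqrt (var_nu \<nu> h * var_nu \<nu> k)"
    by (rule real_sqrt_le_mono)
  then show ?thesis
    by (simp add: real_sqrt_mult)
qed

lemma sqrt_var_add:
  assumes "h \<in> blip0 \<nu>" "k \<in> blip0 \<nu>"
  shows "sqrt (var_nu \<nu> (\<lambda>x. h x + k x)) \<le> sqrt (var_nu \<nu> h) + sqrt (var_nu \<nu> k)"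
proof (rule real_le_lsqrt)
  have "var_nu \<nu> (\<lambda>x. h x + k x) = cov_nu \<nu> h (\<lambda>x. h x + k x) + cov_nu \<nu> k (\<lambda>x. h x + k x)"
    unfolding var_nu_def by (rule cov_add_left[OF assms blip0_add[OF assms]])
  also have "\<dots> = var_nu \<nu> h + 2 * cov_nu \<nu> h k + var_nu \<nu> k"
    using cov_add_left[OF assms assms(1)] cov_add_left[OF assms assms(2)]
      cov_sym[of h "\<lambda>x. h x + k x"] cov_sym[of k "\<lambda>x. h x + k x"] cov_sym[of k h]
    by (simp add: var_nu_def)
  also have "\<dots> \<le> (sqrt (var_nu \<nu> h) + sqrt (var_nu \<nu> k))\<^sup>2"
    using cov_le_sqrt_var[OF assms] var_nonneg assms by (simp add: power2_sum)
  finally show "var_nu \<nu> (\<lambda>x. h x + k x) \<le> (sqrt (var_nu \<nu> h) + sqrt (var_nu \<nu> k))\<^sup>2" .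
qed (use var_nonneg assms in auto)

lemma L2_dist_eq: "h \<in> blip0 \<nu> \<Longrightarrow> k \<in> blip0 \<nu> \<Longrightarrow> L2_dist \<nu> h k = sqrt (var_nu \<nu> (\<lambda>x. h x - k x))"
  by (simp add: L2_dist_def var_nu_def cov_blip0 blip0_diff power2_eq_square)

lemma L2_dist_commute: "L2_dist \<nu> h k = L2_dist \<nu> k h"
  by (simp add: L2_dist_def power2_commute)

lemma L2_dist_triangle:
  assumes "h \<in> blip0 \<nu>" "k \<in> blip0 \<nu>" "l \<in> blip0 \<nu>"
  shows "L2_dist \<nu> h l \<le> L2_dist \<nu> h k + L2_dist \<nu> k l"
  using sqrt_var_add[OF blip0_diff[OF assms(1,2)] blip0_diff[OF assms(2,3)]]
  by (simp add: L2_dist_eq assms)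

text \<open>The projection of \<open>k\<close> is an admissible competitor for \<open>h\<close>.
  Thus the distance to the span is 1-Lipschitz for \<open>L2_dist\<close>, which allows the supremum
  over \<open>P\<close> to be taken over a dense subset.\<close>

lemma sqrt_resid_var_triangle:
  assumes u: "\<And>i. u i \<in> blip0 \<nu>" and "h \<in> blip0 \<nu>" "k \<in> blip0 \<nu>"
  shows "sqrt (resid_var_nu \<nu> h u n) \<le> L2_dist \<nu> h k + sqrt (resid_var_nu \<nu> k u n)"
proof -
  let ?p = "gs_proj (cov_nu \<nu>) u k n"
  have p: "?p \<in> blip0 \<nu>"
    by (rule gs_proj_blip0[OF u assms(3)])
  have c: "(\<lambda>x. k x - ?p x) \<in> comb u n"
    by (rule gs_proj_diff_comb[OF u])
  have "resid_var_nu \<nu> h u n \<le> var_nu \<nu> (\<lambda>x. h x - (k x - ?p x))"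
    unfolding resid_var_comb
  proof (rule cINF_lower[OF _ c])
    have "comb u n \<subseteq> blip0 \<nu>"
      using comb_blip0 u by blast
    then show "bdd_below ((\<lambda>v. var_nu \<nu> (\<lambda>x. h x - v x)) ` comb u n)"
      by (intro bdd_belowI2[where m = 0] var_nonneg blip0_diff assms) auto
  qed
  then have "sqrt (resid_var_nu \<nu> h u n) \<le> sqrt (var_nu \<nu> (\<lambda>x. (h x - k x) + ?p x))"
    by (simp add: algebra_simps)
  also have "\<dots> \<le> L2_dist \<nu> h k + sqrt (resid_var_nu \<nu> k u n)"
    using sqrt_var_add[OF blip0_diff[OF assms(2,3)] p] by (simp add: L2_dist_eq resid_var_eq_gs_proj u assms)
  finally show ?thesis .
qed

text \<open>Without a finite net one could choose a sequence in \<open>P\<close> whose images have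
  mutual distances at least \<epsilon>. Consecutive terms of a convergent subsequence eventually lie
  within \<epsilon>/2 of the limit, a contradiction.\<close>

lemma L2_compact_finite_net:
  assumes "L2_compact \<nu> P g" "\<And>\<mu>. \<mu> \<in> P \<Longrightarrow> g \<mu> \<in> blip0 \<nu>" "\<epsilon> > 0"
  shows "\<exists>F. finite F \<and> F \<subseteq> P \<and> (\<forall>\<mu>\<in>P. \<exists>\<mu>'\<in>F. L2_dist \<nu> (g \<mu>) (g \<mu>') < \<epsilon>)"
proof (rule ccontr)
  assume no_net: "\<not> ?thesis"
  let ?Q = "\<lambda>s n r. r \<in> P \<and> (\<forall>i<n. \<not> L2_dist \<nu> (g (s i)) (g r) < \<epsilon>)"
  have "\<exists>s. \<forall>n::nat. ?Q s n (s n)"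
  proof (rule dependent_wellorder_choice)
    fix n :: nat and s :: "nat \<Rightarrow> 'b"
    assume "\<And>y. y < n \<Longrightarrow> ?Q s y (s y)"
    then have "s ` {..<n} \<subseteq> P"
      by auto
    then obtain r where "r \<in> P" "\<forall>\<mu>'\<in>s ` {..<n}. \<not> L2_dist \<nu> (g r) (g \<mu>') < \<epsilon>"
      using no_net by (meson finite_imageI finite_lessThan)
    then show "\<exists>r. ?Q s n r"
      by (auto simp: L2_dist_commute[of "g r"])
  qed simp
  then obtain s where sQ: "\<And>n::nat. ?Q s n (s n)"
    by auto
  have s: "\<And>n. s n \<in> P" "\<And>i n. i < n \<Longrightarrow> \<epsilon> \<le> L2_dist \<nu> (g (s i)) (g (s n))"
    using sQ by (auto simp: not_less)
  obtain r \<mu> where r: "strict_mono (r :: nat \<Rightarrow> nat)" "\<mu> \<in> P"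
      "(\<lambda>j. L2_dist \<nu> (g (s (r j))) (g \<mu>)) \<longlonglongrightarrow> 0"
    using assms(1)[unfolded L2_compact_def, rule_format, of s] s(1) by auto
  have "eventually (\<lambda>j. L2_dist \<nu> (g (s (r j))) (g \<mu>) < \<epsilon> / 2) sequentially"
    using assms(3) by (intro order_tendstoD(2)[OF r(3)]) simp
  then obtain j where j: "\<And>i. i \<ge> j \<Longrightarrow> L2_dist \<nu> (g (s (r i))) (g \<mu>) < \<epsilon> / 2"
    by (auto simp: eventually_sequentially)
  have "\<epsilon> \<le> L2_dist \<nu> (g (s (r j))) (g (s (r (Suc j))))"
    using r(1) by (intro s(2)) (simp add: strict_mono_Suc_iff)
  also have "\<dots> \<le> L2_dist \<nu> (g (s (r j))) (g \<mu>) + L2_dist \<nu> (g \<mu>) (g (s (r (Suc j))))"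
    by (intro L2_dist_triangle assms(2) s r)
  also have "\<dots> < \<epsilon>"
    using j[of j] j[of "Suc j"] by (simp add: L2_dist_commute[of "g \<mu>"])
  finally show False
    by simp
qed

lemma L2_compact_separable:
  assumes "L2_compact \<nu> P g" "\<And>\<mu>. \<mu> \<in> P \<Longrightarrow> g \<mu> \<in> blip0 \<nu>"
  obtains D where "countable D" "D \<subseteq> P" "\<And>\<mu> \<epsilon>. \<mu> \<in> P \<Longrightarrow> \<epsilon> > 0 \<Longrightarrow> \<exists>\<mu>'\<in>D. L2_dist \<nu> (g \<mu>) (g \<mu>') < \<epsilon>"
proof -
  have "\<forall>n. \<exists>F. finite F \<and> F \<subseteq> P \<and> (\<forall>\<mu>\<in>P. \<exists>\<mu>'\<in>F. L2_dist \<nu> (g \<mu>) (g \<mu>') < inverse (real (Suc n)))"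
    using L2_compact_finite_net[OF assms] by simp
  then obtain F where F: "\<And>n. finite (F n)" "\<And>n. F n \<subseteq> P"
      "\<And>n \<mu>. \<mu> \<in> P \<Longrightarrow> \<exists>\<mu>'\<in>F n. L2_dist \<nu> (g \<mu>) (g \<mu>') < inverse (real (Suc n))"
    by metis
  show ?thesis
  proof (rule that[of "\<Union>n. F n"])
    fix \<mu> and \<epsilon> :: real assume "\<mu> \<in> P" "\<epsilon> > 0"
    obtain n where "inverse (real (Suc n)) < \<epsilon>"
      using reals_Archimedean[OF \<open>\<epsilon> > 0\<close>] by auto
    then show "\<exists>\<mu>'\<in>\<Union>n. F n. L2_dist \<nu> (g \<mu>) (g \<mu>') < \<epsilon>"
      using F(3)[OF \<open>\<mu> \<in> P\<close>, of n] by (meson UN_I UNIV_I less_trans)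
  qed (use F in \<open>auto intro: countable_finite\<close>)
qed

lemma bdd_above_sqrt_resid_var:
  assumes "bdd_above ((\<lambda>\<mu>. sqrt (var_nu \<nu> (g \<mu>))) ` P)" "\<And>\<mu>. \<mu> \<in> P \<Longrightarrow> g \<mu> \<in> blip0 \<nu>"
    and u: "\<And>i. u i \<in> blip0 \<nu>"
  shows "bdd_above ((\<lambda>\<mu>. sqrt (resid_var_nu \<nu> (g \<mu>) u n)) ` P)"
proof -
  obtain B where B: "\<And>\<mu>. \<mu> \<in> P \<Longrightarrow> sqrt (var_nu \<nu> (g \<mu>)) \<le> B"
    using assms(1) by (auto simp: bdd_above_def)
  show ?thesis
    using resid_var_le_var[OF u assms(2)]
    by (intro bdd_aboveI2[where M = B] order_trans[OF _ B] real_sqrt_le_mono)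
qed

text \<open>The countable dense set is chosen once, independently of the outcome, so the supremum
  equals a countable supremum of measurable functions at every outcome.\<close>

lemma SUP_resid_var_measurable:
  assumes compact: "L2_compact \<nu> P g" and g: "\<And>\<mu>. \<mu> \<in> P \<Longrightarrow> g \<mu> \<in> blip0 \<nu>"
    and bdd: "bdd_above ((\<lambda>\<mu>. sqrt (var_nu \<nu> (g \<mu>))) ` P)" and "P \<noteq> {}"
    and U: "\<And>i. i < n \<Longrightarrow> (\<lambda>p. U (fst p) i (snd p)) \<in> borel_measurable (N \<Otimes>\<^sub>M \<nu>)"
      "\<And>\<omega> i. \<omega> \<in> space N \<Longrightarrow> U \<omega> i \<in> blip0 \<nu>"
  shows "(\<lambda>\<omega>. SUP \<mu>\<in>P. sqrt (resid_var_nu \<nu> (g \<mu>) (U \<omega>) n)) \<in> borel_measurable N"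
proof -
  obtain D where D: "countable D" "D \<subseteq> P" "\<And>\<mu> \<epsilon>. \<mu> \<in> P \<Longrightarrow> \<epsilon> > 0 \<Longrightarrow> \<exists>\<mu>'\<in>D. L2_dist \<nu> (g \<mu>) (g \<mu>') < \<epsilon>"
    using L2_compact_separable[OF compact g] by blast
  have "D \<noteq> {}"
    using D(3)[of _ 1] \<open>P \<noteq> {}\<close> by auto
  have bdd': "bdd_above ((\<lambda>\<mu>. sqrt (resid_var_nu \<nu> (g \<mu>) (U \<omega>) n)) ` P)" if "\<omega> \<in> space N" for \<omega>
    by (rule bdd_above_sqrt_resid_var[OF bdd g U(2)[OF that]])
  have bddD: "bdd_above ((\<lambda>\<mu>. sqrt (resid_var_nu \<nu> (g \<mu>) (U \<omega>) n)) ` D)" if "\<omega> \<in> space N" for \<omega>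
    using bdd'[OF that] D(2) by (meson bdd_above_mono image_mono)
  have eq: "(SUP \<mu>\<in>D. sqrt (resid_var_nu \<nu> (g \<mu>) (U \<omega>) n)) = (SUP \<mu>\<in>P. sqrt (resid_var_nu \<nu> (g \<mu>) (U \<omega>) n))"
    if \<omega>: "\<omega> \<in> space N" for \<omega>
  proof (rule antisym)
    show "(SUP \<mu>\<in>D. sqrt (resid_var_nu \<nu> (g \<mu>) (U \<omega>) n)) \<le> (SUP \<mu>\<in>P. sqrt (resid_var_nu \<nu> (g \<mu>) (U \<omega>) n))"
      by (rule cSUP_subset_mono[OF \<open>D \<noteq> {}\<close> bdd'[OF \<omega>] D(2)]) simp
    show "(SUP \<mu>\<in>P. sqrt (resid_var_nu \<nu> (g \<mu>) (U \<omega>) n)) \<le> (SUP \<mu>\<in>D. sqrt (resid_var_nu \<nu> (g \<mu>) (U \<omega>) n))"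
    proof (rule cSUP_least[OF \<open>P \<noteq> {}\<close>], rule field_le_epsilon)
      fix \<mu> and \<epsilon> :: real assume "\<mu> \<in> P" "\<epsilon> > 0"
      then obtain \<mu>' where \<mu>': "\<mu>' \<in> D" "L2_dist \<nu> (g \<mu>) (g \<mu>') < \<epsilon>"
        using D(3) by blast
      have "sqrt (resid_var_nu \<nu> (g \<mu>) (U \<omega>) n) \<le> L2_dist \<nu> (g \<mu>) (g \<mu>') + sqrt (resid_var_nu \<nu> (g \<mu>') (U \<omega>) n)"
        using \<mu>' D(2) \<open>\<mu> \<in> P\<close> by (intro sqrt_resid_var_triangle U(2)[OF \<omega>] g) auto
      also have "\<dots> \<le> \<epsilon> + (SUP \<mu>\<in>D. sqrt (resid_var_nu \<nu> (g \<mu>) (U \<omega>) n))"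
        using \<mu>' by (intro add_mono cSUP_upper bddD \<omega>) auto
      finally show "sqrt (resid_var_nu \<nu> (g \<mu>) (U \<omega>) n) \<le> (SUP \<mu>\<in>D. sqrt (resid_var_nu \<nu> (g \<mu>) (U \<omega>) n)) + \<epsilon>"
        by simp
    qed
  qed
  have "(\<lambda>\<omega>. SUP \<mu>\<in>D. sqrt (resid_var_nu \<nu> (g \<mu>) (U \<omega>) n)) \<in> borel_measurable N"
  proof (rule borel_measurable_cSUP[OF D(1) _ bddD])
    fix \<mu> assume "\<mu> \<in> D"
    then have g\<mu>: "g \<mu> \<in> blip0 \<nu>"
      using g D(2) by auto
    then have [measurable]: "g \<mu> \<in> borel_measurable \<nu>"
      using blip0_measurable by (simp add: measurable_cong_sets[OF sets_borel refl])
    have "(\<lambda>\<omega>. resid_var_nu \<nu> (g \<mu>) (U \<omega>) n) \<in> borel_measurable N"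
      by (rule resid_var_measurable) (auto intro: U g\<mu>)
    then show "(\<lambda>\<omega>. sqrt (resid_var_nu \<nu> (g \<mu>) (U \<omega>) n)) \<in> borel_measurable N"
      by simp
  qed
  then show ?thesis
    by (rule measurable_cong[THEN iffD1, rotated]) (rule eq)
qed

section \<open>Measurability of the deviation in the sample\<close>

lemma emp_dev_le:
  assumes int: "integrable \<nu> (norm :: 'a \<Rightarrow> real)" and m: "m \<ge> 1"
  shows "emp_dev \<nu> z m \<le> emp_dev \<nu> z' m + (\<Sum>k<m. dist (z k) (z' k)) / real m"
  unfolding emp_dev_def[of \<nu> z]
proof (rule cSUP_least)
  show "{h :: 'a \<Rightarrow> real. 1-lipschitz_on UNIV h} \<noteq> {}"
    using lipschitz_on_mono[OF lipschitz_on_constant[of UNIV "0::real"], of UNIV 1] by auto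
  fix h :: "'a \<Rightarrow> real" assume "h \<in> {h. 1-lipschitz_on UNIV h}"
  then have h: "1-lipschitz_on UNIV h"
    by simp
  \<comment> \<open>Pairing the k-th points of both samples bounds the change uniformly in
    \<open>h\<close>; this is the coupling bound for the Wasserstein distance.\<close>
  have "\<bar>h (z' k) - h (z k)\<bar> \<le> dist (z k) (z' k)" for k
    using lipschitz_onD[OF h, of "z k" "z' k"] by (simp add: dist_real_def abs_minus_commute)
  then have "\<bar>\<Sum>k<m. h (z' k) - h (z k)\<bar> \<le> (\<Sum>k<m. dist (z k) (z' k))"
    by (rule order_trans[OF sum_abs sum_mono])
  then have "\<bar>\<Sum>k<m. h (z' k) - h (z k)\<bar> / real m \<le> (\<Sum>k<m. dist (z k) (z' k)) / real m"
    by (rule divide_right_mono) simp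
  moreover have "emp_mean z' m h - emp_mean z m h = (\<Sum>k<m. h (z' k) - h (z k)) / real m"
    by (simp add: emp_mean_def sum_subtractf diff_divide_distrib)
  ultimately have "\<bar>emp_mean z' m h - emp_mean z m h\<bar> \<le> (\<Sum>k<m. dist (z k) (z' k)) / real m"
    by (simp add: abs_divide)
  then  show "\<bar>(\<integral>x. h x \<partial>\<nu>) - emp_mean z m h\<bar> \<le> emp_dev \<nu> z' m + (\<Sum>k<m. dist (z k) (z' k)) / real m"
    using emp_dev_lipschitz[OF int m h, of z'] by linarith
qed

text \<open>A supremum over an uncountable class, but continuous in the sample by
  \<open>emp_dev_le\<close>.\<close>

lemma emp_dev_measurable:
  assumes int: "integrable \<nu> (norm :: 'a \<Rightarrow> real)" and m: "m \<ge> 1"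
  shows "(\<lambda>z. emp_dev \<nu> z m) \<in> borel_measurable (PiM {..<m} (\<lambda>_. \<nu>))"
proof -
  have "continuous_on UNIV (\<lambda>z. emp_dev \<nu> z m)"
    unfolding continuous_on_def
  proof
    fix z :: "nat \<Rightarrow> 'a"
    have "continuous_on UNIV (\<lambda>z' :: nat \<Rightarrow> 'a. (\<Sum>k<m. dist (z' k) (z k)) / real m)"
      by (intro continuous_on_divide continuous_on_sum continuous_on_dist continuous_on_product_coordinates
          continuous_on_const) (use m in auto)
    then have "((\<lambda>z'. (\<Sum>k<m. dist (z' k) (z k)) / real m) \<longlongrightarrow> 0) (at z)"
      by (auto simp: continuous_on_def dest!: spec[of _ z])
    moreover have "norm (emp_dev \<nu> z' m - emp_dev \<nu> z m) \<le> (\<Sum>k<m. dist (z' k) (z k)) / real m" for z'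
      using emp_dev_le[OF int m, of z z'] emp_dev_le[OF int m, of z' z] by (simp add: dist_commute)
    ultimately have "((\<lambda>z'. emp_dev \<nu> z' m - emp_dev \<nu> z m) \<longlongrightarrow> 0) (at z)"
      by (rule Lim_null_comparison[OF always_eventually[OF allI], rotated])
    then show "((\<lambda>z. emp_dev \<nu> z m) \<longlongrightarrow> emp_dev \<nu> z m) (at z)"
      by (rule LIM_zero_cancel)
  qed
  then have "(\<lambda>z. emp_dev \<nu> z m) \<in> borel_measurable borel"
    by (rule borel_measurable_continuous_onI)
  then have *: "(\<lambda>z. emp_dev \<nu> z m) \<in> borel_measurable (PiM UNIV (\<lambda>_. borel))"
    by (simp add: measurable_cong_sets[OF sets_PiM_equal_borel refl])
  \<comment> \<open>Continuity was shown on the space of all sequences. Samples in the finite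
    product are extended by 0, which leaves the deviation unchanged because only indices below m
    enter.\<close>
  have "(\<lambda>z i. if i < m then z i else 0) \<in> measurable (PiM {..<m} (\<lambda>_. \<nu>)) (PiM UNIV (\<lambda>_. borel))"
  proof (rule measurable_PiM_single')
    fix i :: nat
    have "(\<lambda>z. z i) \<in> borel_measurable (PiM {..<m} (\<lambda>_. \<nu>))" if "i < m"
      using measurable_component_singleton[of i "{..<m}" "\<lambda>_. \<nu>"] that
      by (simp add: measurable_cong_sets[OF refl sets_borel])
    then show "(\<lambda>z. if i < m then z i else 0) \<in> borel_measurable (PiM {..<m} (\<lambda>_. \<nu>))"
      by (cases "i < m") auto
  qed auto
  from measurable_compose[OF this *]
  have "(\<lambda>z. emp_dev \<nu> (\<lambda>i. if i < m then z i else 0) m) \<in> borel_measurable (PiM {..<m} (\<lambda>_. \<nu>))" .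
  then show ?thesis
    by (simp add: emp_dev_def emp_mean_def)
qed

end

subsection \<open>Concentration conditionally on the past batches\<close>

lemma phi_conc_pos: "0 < \<kappa> \<Longrightarrow> 0 < phi_conc d \<alpha> \<kappa>"
proof -
  assume "0 < \<kappa>"
  moreover from this have "0 < ln (2 + 1 / \<kappa>)"
    by (intro ln_gt_zero) (simp add: add_pos_pos)
  ultimately show ?thesis
    by (auto simp: phi_conc_def)
qed

text \<open>The required sample size is the exponential tail bound solved for m; multiplying back
  uses that \<open>phi_conc\<close> is positive.\<close>

lemma conc_bound_le:
  assumes "c > 0" "C > 0" "\<delta> > 0" "\<kappa> > 0" "- ln (\<delta> / C) / (c * phi_conc d \<alpha> \<kappa>) \<le> m"
  shows "C * exp (- c * m * phi_conc d \<alpha> \<kappa>) \<le> \<delta>"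
proof -
  have "c * phi_conc d \<alpha> \<kappa> > 0"
    using assms phi_conc_pos by simp
  then have "- c * m * phi_conc d \<alpha> \<kappa> \<le> ln (\<delta> / C)"
    using assms(5) by (simp add: field_simps)
  then have "exp (- c * m * phi_conc d \<alpha> \<kappa>) \<le> exp (ln (\<delta> / C))"
    by simp
  also have "\<dots> = \<delta> / C"
    using assms by simp
  finally show ?thesis
    using assms by (simp add: field_simps)
qed

text \<open>No union bound is paid for an uncountable \<open>S\<close>: the events are nested, so
  their union is \<open>Inf S \<le> X\<close> or \<open>Inf S < X\<close>, according to whether the
  infimum is attained. In the latter case continuity from below passes the bound \<delta> to the
  union.\<close>

lemma (in finite_measure) measure_exceeds_some_le:
  assumes X [measurable]: "X \<in> borel_measurable M" and S: "bdd_below S" and "0 \<le> \<delta>"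
    and le: "\<And>\<kappa>::real. \<kappa> \<in> S \<Longrightarrow> measure M {\<omega> \<in> space M. \<kappa> \<le> X \<omega>} \<le> \<delta>"
  shows "{\<omega> \<in> space M. \<exists>\<kappa>\<in>S. \<kappa> \<le> X \<omega>} \<in> sets M"
    and "measure M {\<omega> \<in> space M. \<exists>\<kappa>\<in>S. \<kappa> \<le> X \<omega>} \<le> \<delta>"
proof -
  let ?E = "{\<omega> \<in> space M. \<exists>\<kappa>\<in>S. \<kappa> \<le> X \<omega>}"
  consider "S = {}" | "Inf S \<in> S" | "S \<noteq> {}" "Inf S \<notin> S"
    by blast
  then have "?E \<in> sets M \<and> measure M ?E \<le> \<delta>"
  proof cases
    case 1
    then show ?thesis using \<open>0 \<le> \<delta>\<close> by simp
  next
    case 2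
    then have "?E = {\<omega> \<in> space M. Inf S \<le> X \<omega>}"
      using cInf_lower[OF _ S] by (force intro: order_trans)
    then show ?thesis
      using le[OF 2] by simp
  next
    case 3
    have near: "\<exists>\<kappa>\<in>S. \<kappa> < y" if "Inf S < y" for y
      using cInf_lessD[OF 3(1) that] by blast
    have strict: "Inf S < \<kappa>" if "\<kappa> \<in> S" for \<kappa>
      using cInf_lower[OF that S] 3(2) that by (metis order_le_less)
    have E: "?E = {\<omega> \<in> space M. Inf S < X \<omega>}"
      using near strict by (blast intro: less_imp_le less_le_trans)
    let ?A = "\<lambda>n. {\<omega> \<in> space M. Inf S + inverse (real (Suc n)) \<le> X \<omega>}"
    have "(\<Union>n. ?A n) = ?E"
    proof
      show "?E \<subseteq> (\<Union>n. ?A n)"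
      proof
        fix \<omega> assume "\<omega> \<in> ?E"
        then have "\<omega> \<in> space M" "0 < X \<omega> - Inf S"
          unfolding E by auto
        moreover from this(2) obtain n where "inverse (real (Suc n)) < X \<omega> - Inf S"
          using reals_Archimedean by blast
        ultimately have "\<omega> \<in> ?A n"
          by simp
        then show "\<omega> \<in> (\<Union>n. ?A n)"
          by blast
      qed
      show "(\<Union>n. ?A n) \<subseteq> ?E"
      proof
        fix \<omega> assume "\<omega> \<in> (\<Union>n. ?A n)"
        then obtain n where "\<omega> \<in> space M" "Inf S + inverse (real (Suc n)) \<le> X \<omega>"
          by auto
        moreover have "Inf S < Inf S + inverse (real (Suc n))"
          by simp
        ultimately have "Inf S < X \<omega>"
          by linarith
        then show "\<omega> \<in> ?E"
          using \<open>\<omega> \<in> space M\<close> unfolding E by simp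
      qed
    qed
    moreover have "incseq ?A"
    proof (intro monoI subsetI)
      fix i j :: nat and \<omega> assume "i \<le> j" "\<omega> \<in> ?A i"
      moreover have "inverse (real (Suc j)) \<le> inverse (real (Suc i))"
        using \<open>i \<le> j\<close> by (intro le_imp_inverse_le) auto
      ultimately have "Inf S + inverse (real (Suc j)) \<le> X \<omega>"
        unfolding mem_Collect_eq by linarith
      then show "\<omega> \<in> ?A j"
        using \<open>\<omega> \<in> ?A i\<close> by simp
    qed
    moreover have "range ?A \<subseteq> sets M"
      by auto
    ultimately have "(\<lambda>n. measure M (?A n)) \<longlonglongrightarrow> measure M ?E"
      using finite_Lim_measure_incseq[of ?A] by simp
    moreover have "measure M (?A n) \<le> \<delta>" for n
    proof -
      \<comment> \<open>Some element of \<open>S\<close> lies below the level of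
        \<open>?A n\<close>, so a single hypothesis bounds this set.\<close>
      obtain \<kappa> where \<kappa>: "\<kappa> \<in> S" "\<kappa> < Inf S + inverse (real (Suc n))"
        using near[of "Inf S + inverse (real (Suc n))"] by auto
      then have "measure M (?A n) \<le> measure M {\<omega> \<in> space M. \<kappa> \<le> X \<omega>}"
        by (intro finite_measure_mono) auto
      then show ?thesis
        using le[OF \<kappa>(1)] by simp
    qed
    ultimately have "measure M ?E \<le> \<delta>"
      by (intro LIMSEQ_le_const2) auto
    then show ?thesis
      unfolding E by simp
  qed
  then show "?E \<in> sets M" "measure M ?E \<le> \<delta>"
    by auto
qed

text \<open>The hypothesis is tested on the set where the conditional probability is below c: the
  integral of the shortfall over it is at most 0 while the integrand is positive there, so the set
  is null.\<close>

lemma (in prob_space) real_cond_exp_indicator_ge: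
  assumes sub: "subalgebra M F" and G: "G \<in> events"
    and ge: "\<And>A. A \<in> sets F \<Longrightarrow> c * prob A \<le> prob (A \<inter> G)"
  shows "AE \<omega> in M. c \<le> real_cond_exp M F (indicator G) \<omega>"
proof -
  interpret finite_measure_subalgebra M F
    by unfold_locales (rule sub)
  let ?r = "real_cond_exp M F (indicator G :: 'a \<Rightarrow> real)"
  let ?A = "{\<omega> \<in> space M. ?r \<omega> < c}"
  have sp: "space F = space M"
    using sub by (simp add: subalgebra_def)
  have [measurable]: "?r \<in> borel_measurable F" "?r \<in> borel_measurable M"
    by auto
  have AF: "?A \<in> sets F"
    unfolding sp[symmetric] by measurable
  have A [measurable]: "?A \<in> sets M"
    by measurable
  have intG: "integrable M (indicator G :: 'a \<Rightarrow> real)"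
    using G by (simp add: integrable_indicator_iff emeasure_eq_measure)
  have intr: "integrable M ?r"
    by (rule real_cond_exp_int(1)[OF intG])
  have i1: "integrable M (\<lambda>\<omega>. indicator ?A \<omega> * ?r \<omega>)"
    using integrable_mult_indicator[OF A intr] by simp
  have i2: "integrable M (\<lambda>\<omega>. indicator ?A \<omega> * c)"
    using A by (simp add: integrable_indicator_iff emeasure_eq_measure)
  have "(\<integral>\<omega>. indicator ?A \<omega> * ?r \<omega> \<partial>M) = (\<integral>\<omega>. indicator ?A \<omega> * indicator G \<omega> \<partial>M)"
    using real_cond_exp_intA[OF intG AF] by (simp add: set_lebesgue_integral_def)
  also have "\<dots> = prob (?A \<inter> G)"
    using A G by (simp add: indicator_inter_arith[symmetric])
  also have "\<dots> \<ge> c * prob ?A"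
    by (rule ge[OF AF])
  finally have "(\<integral>\<omega>. indicator ?A \<omega> * c - indicator ?A \<omega> * ?r \<omega> \<partial>M) \<le> 0"
    using i1 i2 A by (simp add: mult.commute)
  moreover have nn: "0 \<le> indicator ?A \<omega> * c - indicator ?A \<omega> * ?r \<omega>" for \<omega>
    by (auto simp: indicator_def)
  ultimately have "(\<integral>\<omega>. indicator ?A \<omega> * c - indicator ?A \<omega> * ?r \<omega> \<partial>M) = 0"
    by (intro antisym Bochner_Integration.integral_nonneg) auto
  then have "AE \<omega> in M. indicator ?A \<omega> * c - indicator ?A \<omega> * ?r \<omega> = 0"
    using integral_nonneg_eq_0_iff_AE[of M "\<lambda>\<omega>. indicator ?A \<omega> * c - indicator ?A \<omega> * ?r \<omega>"] i1 i2 nn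
    by simp
  then show ?thesis
    using AE_space by eventually_elim (auto simp: indicator_def split: if_splits)
qed

section \<open>The sigma-algebras of past batches and independence of the next one\<close>

lemma space_sample_alg [simp]: "space (sample_alg M Zs n) = space M"
  unfolding sample_alg_def by (rule space_measure_of) auto

lemma sets_sample_alg: "sets (sample_alg M Zs n)
  = sigma_sets (space M) {Zs j k -` A \<inter> space M | j k A. 1 \<le> j \<and> j \<le> n \<and> A \<in> sets borel}"
  unfolding sample_alg_def by (rule sets_measure_of) auto

lemma sets_sample_alg_mono: "m \<le> n \<Longrightarrow> sets (sample_alg M Zs m) \<subseteq> sets (sample_alg M Zs n)"
  unfolding sets_sample_alg by (intro sigma_sets_mono') (auto, blast intro: order_trans)

lemma subalgebra_sample_alg:
  assumes "\<And>j k. 1 \<le> j \<Longrightarrow> Zs j k \<in> borel_measurable M"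
  shows "subalgebra M (sample_alg M Zs n)"
  unfolding subalgebra_def sets_sample_alg
  using assms by (auto intro!: sets.sigma_sets_subset measurable_sets)

lemma (in prob_space) samples_measurable:
  assumes "indep_vars (\<lambda>_. borel) (\<lambda>i. case i of None \<Rightarrow> Z | Some (n, k) \<Rightarrow> Zs n k)
      ({None} \<union> {Some (n, k) | n k. 1 \<le> n})"
    and "1 \<le> j"
  shows "Zs j k \<in> borel_measurable M"
proof -
  have "Some (j, k) \<in> {None} \<union> {Some (n, k) | n k. 1 \<le> n}"
    using assms(2) by auto
  from bspec[OF conjunct1[OF assms(1)[unfolded indep_vars_def]] this] show ?thesis
    by simp
qed

text \<open>Past and current batch are functions of the samples over the disjoint index sets
  \<open>?K0\<close> and \<open>?K1\<close>, so they are independent. For n = 1 the set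
  \<open>?K0\<close> is empty and the past is trivial.\<close>

lemma (in prob_space) prob_past_batch:
  fixes \<nu> :: "'b::euclidean_space measure"
  assumes indep: "indep_vars (\<lambda>_. borel) (\<lambda>i. case i of None \<Rightarrow> Z | Some (n, k) \<Rightarrow> Zs n k)
      ({None} \<union> {Some (n, k) | n k. 1 \<le> n})"
    and law: "\<And>n k. 1 \<le> n \<Longrightarrow> distr M borel (Zs n k) = \<nu>"
    and n: "1 \<le> n" and m: "1 \<le> m"
    and A: "A \<in> sets (sample_alg M Zs (n - 1))"
    and B: "B \<in> sets (PiM {..<m} (\<lambda>_. \<nu>))"
  shows "prob (A \<inter> {\<omega> \<in> space M. (\<lambda>k\<in>{..<m}. Zs n k \<omega>) \<in> B})
    = prob A * measure (PiM {..<m} (\<lambda>_. \<nu>)) B"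
proof -
  let ?X = "\<lambda>i. case i of None \<Rightarrow> Z | Some (n, k) \<Rightarrow> Zs n k"
  let ?K0 = "{Some (j, k) | j k. 1 \<le> j \<and> j \<le> n - 1}" and ?K1 = "(\<lambda>k. Some (n, k)) ` {..<m}"
  let ?Y0 = "\<lambda>\<omega>. restrict (\<lambda>i. ?X i \<omega>) ?K0" and ?Y1 = "\<lambda>\<omega>. restrict (\<lambda>i. ?X i \<omega>) ?K1"
  let ?N0 = "PiM ?K0 (\<lambda>_. borel :: 'b measure)" and ?N1 = "PiM ?K1 (\<lambda>_. borel :: 'b measure)"
  have iv: "indep_var ?N0 ?Y0 ?N1 ?Y1"
    using n by (intro indep_var_restrict[OF indep]) auto
  have sets_nu: "sets \<nu> = sets borel"
    using law[OF n, of 0] by (metis sets_distr)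
  have setsPi: "sets (PiM {..<m} (\<lambda>_. \<nu>)) = sets (PiM {..<m} (\<lambda>_. borel))"
    by (intro sets_PiM_cong) (auto simp: sets_nu)
  have Zm: "Zs j k \<in> borel_measurable M" if "1 \<le> j" for j k
    by (rule samples_measurable[OF indep that])
  have Y0: "?Y0 \<in> measurable M ?N0"
    using indep_var_rv1[OF iv] .
  \<comment> \<open>It suffices to treat the generators; afterwards every past event is the preimage
    of a set \<open>A'\<close> under the vector \<open>?Y0\<close>.\<close>
  have "A \<in> sets (vimage_algebra (space M) ?Y0 ?N0)"
  proof -
    have "sigma_sets (space M) {Zs j k -` A \<inter> space M | j k A. 1 \<le> j \<and> j \<le> n - 1 \<and> A \<in> sets borel}
      \<subseteq> sets (vimage_algebra (space M) ?Y0 ?N0)"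
    proof -
      have "Zs j k -` D \<inter> space M \<in> sets (vimage_algebra (space M) ?Y0 ?N0)"
        if "1 \<le> j" "j \<le> n - 1" "D \<in> sets borel" for j k D
      proof -
        have i: "Some (j, k) \<in> ?K0"
          using that by auto
        have "(\<lambda>y. y (Some (j, k))) -` D \<inter> space ?N0 \<in> sets ?N0"
          using measurable_sets[OF measurable_component_singleton[OF i] that(3)] .
        then have "?Y0 -` ((\<lambda>y. y (Some (j, k))) -` D \<inter> space ?N0) \<inter> space M
            \<in> sets (vimage_algebra (space M) ?Y0 ?N0)"
          by (rule in_vimage_algebra)
        also have "?Y0 -` ((\<lambda>y. y (Some (j, k))) -` D \<inter> space ?N0) \<inter> space M = Zs j k -` D \<inter> space M"
          using i by (auto simp: space_PiM)
        finally show ?thesis .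
      qed
      then have "{Zs j k -` A \<inter> space M | j k A. 1 \<le> j \<and> j \<le> n - 1 \<and> A \<in> sets borel}
          \<subseteq> sets (vimage_algebra (space M) ?Y0 ?N0)"
        by blast
      from sets.sigma_sets_subset[OF this] show ?thesis
        unfolding space_vimage_algebra .
    qed
    then show ?thesis
      using A unfolding sets_sample_alg by auto
  qed
  then obtain A' where A': "A' \<in> sets ?N0" "A = ?Y0 -` A' \<inter> space M"
    using Y0 by (auto simp: sets_vimage_algebra2 measurable_def)
  let ?T = "\<lambda>y. \<lambda>k\<in>{..<m}. y (Some (n, k))"
  have T: "?T \<in> measurable ?N1 (PiM {..<m} (\<lambda>_. borel))"
    by (intro measurable_restrict measurable_component_singleton) auto
  let ?B' = "?T -` B \<inter> space ?N1"
  have B': "?B' \<in> sets ?N1"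
    using measurable_sets[OF T] B setsPi by auto
  have Y1B: "?Y1 -` ?B' \<inter> space M = {\<omega> \<in> space M. (\<lambda>k\<in>{..<m}. Zs n k \<omega>) \<in> B}"
  proof -
    have "?T (?Y1 \<omega>) = (\<lambda>k\<in>{..<m}. Zs n k \<omega>)" for \<omega>
      by (auto simp: fun_eq_iff)
    moreover have "?Y1 \<omega> \<in> space ?N1" for \<omega>
      by (simp add: space_PiM)
    ultimately show ?thesis
      by auto
  qed
  have inj: "inj_on (\<lambda>k. Some (n, k)) {..<m}"
    by (auto simp: inj_on_def)
  have prob_nu: "prob_space \<nu>"
    using prob_space_distr[OF Zm[OF n, of 0]] law[OF n] by simp
  have "indep_vars (\<lambda>_. borel) ?X ?K1"
    using n by (intro indep_vars_subset[OF indep]) auto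
  then have "distr M ?N1 ?Y1 = PiM ?K1 (\<lambda>i. distr M borel (?X i))"
    using n m Zm by (subst (asm) indep_vars_iff_distr_eq_PiM') (auto simp: lessThan_empty_iff)
  also have "\<dots> = PiM ?K1 (\<lambda>_. \<nu>)"
    using law[OF n] by (intro PiM_cong) auto
  finally have Y1: "distr M ?N1 ?Y1 = PiM ?K1 (\<lambda>_. \<nu>)" .
  have setsN1: "sets (PiM ?K1 (\<lambda>_. \<nu>)) = sets ?N1"
    by (intro sets_PiM_cong) (auto simp: sets_nu)
  \<comment> \<open>The batch is indexed by \<open>Some (n, k)\<close>; reindexing by k brings its
    law to the product over \<open>{..<m}\<close> in which \<open>B\<close> lives.\<close>
  have "distr (PiM ?K1 (\<lambda>_. \<nu>)) (PiM {..<m} (\<lambda>_. \<nu>)) ?T = PiM {..<m} (\<lambda>_. \<nu>)"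
    by (rule distr_PiM_reindex[OF prob_nu inj]) auto
  then have "measure (PiM {..<m} (\<lambda>_. \<nu>)) B = measure (distr (PiM ?K1 (\<lambda>_. \<nu>)) (PiM {..<m} (\<lambda>_. \<nu>)) ?T) B"
    by simp
  also have "\<dots> = measure (PiM ?K1 (\<lambda>_. \<nu>)) (?T -` B \<inter> space (PiM ?K1 (\<lambda>_. \<nu>)))"
    using T B by (intro measure_distr) (simp_all add: measurable_cong_sets[OF setsN1 setsPi])
  also have "?T -` B \<inter> space (PiM ?K1 (\<lambda>_. \<nu>)) = ?B'"
    by (simp add: sets_eq_imp_space_eq[OF setsN1])
  also have "measure (PiM ?K1 (\<lambda>_. \<nu>)) ?B' = prob (?Y1 -` ?B' \<inter> space M)"
    unfolding Y1[symmetric] by (rule measure_distr[OF indep_var_rv2[OF iv] B'])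
  finally have 1: "measure (PiM {..<m} (\<lambda>_. \<nu>)) B = prob (?Y1 -` ?B' \<inter> space M)" .
  have "prob ((\<lambda>\<omega>. (?Y0 \<omega>, ?Y1 \<omega>)) -` (A' \<times> ?B') \<inter> space M) = prob (?Y0 -` A' \<inter> space M) * prob (?Y1 -` ?B' \<inter> space M)"
    by (rule indep_varD[OF iv A'(1) B'])
  also have "(\<lambda>\<omega>. (?Y0 \<omega>, ?Y1 \<omega>)) -` (A' \<times> ?B') \<inter> space M = A \<inter> {\<omega> \<in> space M. (\<lambda>k\<in>{..<m}. Zs n k \<omega>) \<in> B}"
    unfolding Y1B[symmetric] A'(2) by auto
  finally show ?thesis
    unfolding 1 A'(2)[symmetric] .
qed

lemma (in prob_space) prob_past_deviation:
  fixes \<nu> :: "'b::euclidean_space measure" and Ms :: "'a \<Rightarrow> nat" and S :: "nat \<Rightarrow> real set"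
  assumes indep: "indep_vars (\<lambda>_. borel) (\<lambda>i. case i of None \<Rightarrow> Z | Some (n, k) \<Rightarrow> Zs n k)
      ({None} \<union> {Some (n, k) | n k. 1 \<le> n})"
    and law: "\<And>n k. 1 \<le> n \<Longrightarrow> distr M borel (Zs n k) = \<nu>"
    and int: "integrable \<nu> (norm :: 'b \<Rightarrow> real)"
    and n: "1 \<le> n"
    and Ms: "Ms \<in> measurable (sample_alg M Zs (n - 1)) (count_space UNIV)"
      "\<And>\<omega>. \<omega> \<in> space M \<Longrightarrow> 1 \<le> Ms \<omega>"
    and S: "\<And>m. bdd_below (S m)" and "0 \<le> \<delta>"
    and conc: "\<And>m \<kappa>. 1 \<le> m \<Longrightarrow> \<kappa> \<in> S m \<Longrightarrow>
      measure (PiM {..<m} (\<lambda>_. \<nu>)) {z \<in> space (PiM {..<m} (\<lambda>_. \<nu>)). \<kappa> \<le> emp_dev \<nu> z m} \<le> \<delta>"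
    and A: "A \<in> sets (sample_alg M Zs (n - 1))"
  defines "Q \<equiv> {\<omega> \<in> space M. \<exists>\<kappa>\<in>S (Ms \<omega>). \<kappa> \<le> emp_dev \<nu> (\<lambda>k. Zs n k \<omega>) (Ms \<omega>)}"
  shows "Q \<in> events" and "prob (A \<inter> Q) \<le> \<delta> * prob A"
proof -
  have Zm [measurable]: "Zs j k \<in> borel_measurable M" if "1 \<le> j" for j k
    by (rule samples_measurable[OF indep that])
  have sub: "sets (sample_alg M Zs (n - 1)) \<subseteq> events"
    using subalgebra_sample_alg[of Zs M "n - 1", OF Zm] by (simp add: subalgebra_def)
  have sets_nu: "sets \<nu> = sets borel"
    using law[OF n, of 0] by (metis sets_distr)
  interpret \<nu>: prob_space \<nu>
    using prob_space_distr[OF Zm[OF n, of 0]] law[OF n] by simp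
  interpret \<nu>: borel_prob_space \<nu>
    by unfold_locales (rule sets_nu)
  \<comment> \<open>The empty set at m = 0 makes the definition total; the value 0 is never taken by
    \<open>Ms\<close>.\<close>
  define B where "B m = (if m = 0 then {} else
    {z \<in> space (PiM {..<m} (\<lambda>_. \<nu>)). \<exists>\<kappa>\<in>S m. \<kappa> \<le> emp_dev \<nu> z m})" for m
  have B: "B m \<in> sets (PiM {..<m} (\<lambda>_. \<nu>)) \<and> measure (PiM {..<m} (\<lambda>_. \<nu>)) (B m) \<le> \<delta>" if "1 \<le> m" for m
  proof -
    interpret P: prob_space "PiM {..<m} (\<lambda>_. \<nu>)"
      by (rule prob_space_PiM) (rule \<nu>.prob_space_axioms)
    show ?thesis
      using P.measure_exceeds_some_le[OF \<nu>.emp_dev_measurable[OF int that] S \<open>0 \<le> \<delta>\<close> conc[OF that]] that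
      by (simp add: B_def)
  qed
  define E where "E m = {\<omega> \<in> space M. (\<lambda>k\<in>{..<m}. Zs n k \<omega>) \<in> B m}" for m
  define F where "F m = Ms -` {m} \<inter> space M" for m
  have F: "F m \<in> sets (sample_alg M Zs (n - 1))" for m
    using measurable_sets[OF Ms(1), of "{m}"] by (simp add: F_def)
  have E: "E m \<in> events" for m
  proof (cases "m = 0")
    case False
    have "(\<lambda>\<omega>. \<lambda>k\<in>{..<m}. Zs n k \<omega>) \<in> measurable M (PiM {..<m} (\<lambda>_. \<nu>))"
      by (intro measurable_restrict) (simp add: measurable_cong_sets[OF refl sets_nu] Zm[OF n])
    from measurable_sets[OF this, of "B m"] show ?thesis
      using B[of m] False by (simp add: E_def vimage_def Int_def conj_commute)
  qed (simp add: E_def B_def)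
  have Q: "Q = (\<Union>m. F m \<inter> E m)"
  proof -
    have "(\<lambda>k\<in>{..<m}. Zs n k \<omega>) \<in> B m \<longleftrightarrow> (\<exists>\<kappa>\<in>S m. \<kappa> \<le> emp_dev \<nu> (\<lambda>k. Zs n k \<omega>) m)"
      if "1 \<le> m" "\<omega> \<in> space M" for m \<omega>
    proof -
      have "(\<lambda>k\<in>{..<m}. Zs n k \<omega>) \<in> space (PiM {..<m} (\<lambda>_. \<nu>))"
        by (simp add: space_PiM sets_eq_imp_space_eq[OF sets_nu])
      then show ?thesis
        using that by (simp add: B_def emp_dev_def emp_mean_def)
    qed
    then show ?thesis
      using Ms(2) by (auto simp: Q_def E_def F_def)
  qed
  show "Q \<in> events"
    unfolding Q using F sub E by (intro sets.countable_UN sets.Int) auto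
  have AF: "A \<inter> F m \<in> sets (sample_alg M Zs (n - 1))" for m
    using A F by blast
  \<comment> \<open>\<open>A \<inter> F m\<close> is still an event of the past and fixes the batch
    size, so \<open>B m\<close> is deterministic and the product rule applies. Summation over m then
    restores \<open>A\<close> on the right.\<close>
  have le: "prob (A \<inter> F m \<inter> E m) \<le> \<delta> * prob (A \<inter> F m)" for m
  proof (cases "m = 0")
    case True
    then show ?thesis
      using \<open>0 \<le> \<delta>\<close> by (simp add: E_def B_def)
  next
    case False
    then have "prob (A \<inter> F m \<inter> E m) = prob (A \<inter> F m) * measure (PiM {..<m} (\<lambda>_. \<nu>)) (B m)"
      unfolding E_def using B by (intro prob_past_batch[OF indep law n _ AF]) auto
    also have "\<dots> \<le> prob (A \<inter> F m) * \<delta>"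
      using B[of m] False by (intro mult_left_mono) auto
    finally show ?thesis
      by (simp only: mult.commute)
  qed
  have "(\<lambda>m. prob (A \<inter> F m \<inter> E m)) sums prob (\<Union>m. A \<inter> F m \<inter> E m)"
    using AF sub E by (intro finite_measure_UNION) (auto simp: disjoint_family_on_def F_def)
  moreover have "(\<lambda>m. prob (A \<inter> F m)) sums prob (\<Union>m. A \<inter> F m)"
    using AF sub by (intro finite_measure_UNION) (auto simp: disjoint_family_on_def F_def)
  moreover have "(\<Union>m. A \<inter> F m \<inter> E m) = A \<inter> Q"
    unfolding Q by auto
  moreover have "(\<Union>m. A \<inter> F m) = A"
    using A sub sets.sets_into_space[of A M] by (auto simp: F_def)
  ultimately show "prob (A \<inter> Q) \<le> \<delta> * prob A"
    using sums_le[OF le] sums_mult[of "\<lambda>m. prob (A \<inter> F m)" _ \<delta>] by simp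
qed

text \<open>The intersection of the first N events belongs to \<open>F N\<close>, so it may serve as
  the past event for the next one; each step contributes one factor. Independence of the events
  themselves is not assumed.\<close>

lemma (in prob_space) prob_INT_ge_of_conditional:
  assumes F: "\<And>m. subalgebra M (F m)" "\<And>m n. m \<le> n \<Longrightarrow> sets (F m) \<subseteq> sets (F n)"
    and G: "\<And>n. 1 \<le> n \<Longrightarrow> G n \<in> sets (F n)"
    and ge: "\<And>n A. 1 \<le> n \<Longrightarrow> A \<in> sets (F (n - 1)) \<Longrightarrow> p n * prob A \<le> prob (A \<inter> G n)"
    and p: "\<And>n. 1 \<le> n \<Longrightarrow> 0 \<le> p n \<and> p n \<le> 1"
  shows "lim (\<lambda>N. \<Prod>n=1..N. p n) \<le> prob (\<Inter>n\<in>{1..}. G n)"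
proof -
  \<comment> \<open>Intersecting with \<open>space M\<close> matters for N = 0, where the
    intersection over the empty index set is \<open>UNIV\<close>.\<close>
  let ?H = "\<lambda>N. space M \<inter> (\<Inter>n\<in>{1..N}. G n)"
  have sub: "sets (F m) \<subseteq> events" "space (F m) = space M" for m
    using F(1)[of m] by (auto simp: subalgebra_def)
  have H: "?H N \<in> sets (F N)" for N
  proof -
    have "(\<Inter>n\<in>{1..N}. G n) \<inter> space (F N) \<in> sets (F N)"
    proof (cases "N = 0")
      case False
      then show ?thesis
        using G F(2) by (intro sets.Int sets.finite_INT) (auto simp: subset_iff)
    qed (simp add: sets.top)
    then show ?thesis
      by (simp add: sub(2) Int_commute)
  qed
  have le: "(\<Prod>n=1..N. p n) \<le> prob (?H N)" for N
  proof (induction N)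
    case (Suc N)
    have "(\<Prod>n=1..Suc N. p n) \<le> p (Suc N) * prob (?H N)"
      using mult_left_mono[OF Suc.IH, of "p (Suc N)"] p[of "Suc N"] by (simp add: mult.commute)
    also have "\<dots> \<le> prob (?H N \<inter> G (Suc N))"
      using H[of N] by (intro ge) auto
    also have "?H N \<inter> G (Suc N) = ?H (Suc N)"
      by (auto simp: atLeastAtMostSuc_conv)
    finally show ?case .
  qed (simp add: prob_space)
  \<comment> \<open>The operator \<open>lim\<close> says something only for convergent sequences.
    The partial products converge because they decrease and stay nonnegative.\<close>
  have "decseq (\<lambda>N. \<Prod>n=1..N. p n)"
  proof (rule decseq_SucI)
    fix N
    have "0 \<le> (\<Prod>n=1..N. p n)"
      using p by (intro prod_nonneg) auto
    then show "(\<Prod>n=1..Suc N. p n) \<le> (\<Prod>n=1..N. p n)"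
      using p[of "Suc N"] by (simp add: mult_left_le)
  qed
  moreover have "0 \<le> (\<Prod>n=1..N. p n)" for N
    using p by (intro prod_nonneg) auto
  ultimately have "(\<lambda>N. \<Prod>n=1..N. p n) \<longlonglongrightarrow> lim (\<lambda>N. \<Prod>n=1..N. p n)"
    using decseq_convergent[of "\<lambda>N. \<Prod>n=1..N. p n" 0] by (metis convergentI convergent_LIMSEQ_iff)
  moreover have "(\<lambda>N. prob (?H N)) \<longlonglongrightarrow> prob (\<Inter>N. ?H N)"
    using H sub(1) by (intro finite_Lim_measure_decseq) (auto simp: decseq_def)
  ultimately have "lim (\<lambda>N. \<Prod>n=1..N. p n) \<le> prob (\<Inter>N. ?H N)"
    using le by (intro LIMSEQ_le) auto
  also have "(\<Inter>N. ?H N) = (\<Inter>n\<in>{1..}. G n)"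
  proof -
    have "G 1 \<subseteq> space M"
      using G[of 1] sub sets.sets_into_space[of "G 1" M] by auto
    then show ?thesis
    proof (intro antisym subsetI)
      fix \<omega> assume \<omega>: "\<omega> \<in> (\<Inter>N. ?H N)"
      show "\<omega> \<in> (\<Inter>n\<in>{1..}. G n)"
      proof
        fix n :: nat assume "n \<in> {1..}"
        moreover have "\<omega> \<in> ?H n"
          using \<omega> by blast
        ultimately show "\<omega> \<in> G n"
          by auto
      qed
    qed auto
  qed
  finally show ?thesis .
qed

context borel_prob_space
begin

lemma integrable_norm_of_exp_moment:
  assumes "\<alpha> > 1" "\<beta> > 0" "integrable \<nu> (\<lambda>x. exp (\<beta> * norm x powr \<alpha>))"
  shows "integrable \<nu> (norm :: 'a \<Rightarrow> real)"
proof (rule Bochner_Integration.integrable_bound)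
  show "integrable \<nu> (\<lambda>x. 1 + exp (\<beta> * norm x powr \<alpha>) / \<beta>)"
    using assms by (intro Bochner_Integration.integrable_add) auto
  show "norm \<in> borel_measurable \<nu>"
    by measurable
  \<comment> \<open>Outside the unit ball the norm is at most its power \<alpha>, and t \<le> exp t
    with t equal to \<beta> times this power gives the second summand.\<close>
  have "norm x \<le> 1 + exp (\<beta> * norm x powr \<alpha>) / \<beta>" for x :: 'a
  proof (cases "norm x \<le> 1")
    case True
    then show ?thesis
      using assms by (simp add: add_increasing2)
  next
    case False
    have "norm x = norm x powr 1"
      using False by simp
    also have "\<dots> \<le> norm x powr \<alpha>"
      using False assms by (intro powr_mono) auto
    also have "\<dots> \<le> exp (\<beta> * norm x powr \<alpha>) / \<beta>"
    proof -
      have "\<beta> * norm x powr \<alpha> \<le> exp (\<beta> * norm x powr \<alpha>)"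
        using exp_ge_add_one_self[of "\<beta> * norm x powr \<alpha>"] by linarith
      then show ?thesis
        using assms(2) by (simp add: pos_le_divide_eq mult.commute)
    qed
    finally show ?thesis
      by simp
  qed
  then show "AE x in \<nu>. norm (norm x) \<le> norm (1 + exp (\<beta> * norm x powr \<alpha>) / \<beta>)"
    by (auto intro: order_trans[OF _ abs_ge_self])
qed

text \<open>A function of Lipschitz constant 0 is constant, and being centred it is 0. The
  thresholds divide by these norms.\<close>

lemma var_pos_imp_norms_pos:
  assumes h: "h \<in> blip0 \<nu>" and pos: "0 < var_nu \<nu> h"
  shows "0 < linf_norm h" "0 < lip_const h"
proof -
  have nz: "h \<noteq> (\<lambda>_. 0)"
    using pos by (auto simp: var_nu_def cov_zero_left)
  have bd: "bounded (range h)" and lip: "(lip_const h)-lipschitz_on UNIV h" and mean: "(\<integral>x. h x \<partial>\<nu>) = 0"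
    using h by (auto simp: blip0_def intro: lipschitz_on_lip_const)
  obtain x where "h x \<noteq> 0"
    using nz by auto
  then show "0 < linf_norm h"
    using abs_le_linf_norm[OF bd, of x] by linarith
  show "0 < lip_const h"
  proof (rule ccontr)
    assume "\<not> ?thesis"
    then have "lip_const h = 0"
      using lipschitz_on_nonneg[OF lip] by simp
    then have c: "h = (\<lambda>_. h x)"
      using lipschitz_onD[OF lip, of _ x] by (auto simp: fun_eq_iff)
    have "(\<integral>x. h x \<partial>\<nu>) = h x"
      by (subst c) (simp add: prob_space)
    then show False
      using mean \<open>h x \<noteq> 0\<close> by simp
  qed
qed

subsection \<open>The weak greedy inequality\<close>

text \<open>Passing to the supremum in the gap gives \<sigma> squared on the left; moving its
  multiple with 1 - \<gamma>^2 across leaves the square of \<gamma>\<sigma>.\<close>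

lemma weak_greedy_of_resid_gap:
  fixes g :: "'b \<Rightarrow> 'a \<Rightarrow> real"
  assumes \<sigma>_def: "\<sigma> = (SUP \<mu>\<in>P. sqrt (resid_var_nu \<nu> (g \<mu>) u n))"
    and u: "\<And>i. u i \<in> blip0 \<nu>" and h: "h \<in> blip0 \<nu>" and "P \<noteq> {}" and g: "\<And>\<mu>. \<mu> \<in> P \<Longrightarrow> g \<mu> \<in> blip0 \<nu>"
    and \<gamma>: "0 < \<gamma>" "\<gamma> < 1" and \<sigma>: "0 \<le> \<sigma>"
    and gap: "\<And>\<mu>. \<mu> \<in> P \<Longrightarrow> resid_var_nu \<nu> (g \<mu>) u n \<le> resid_var_nu \<nu> h u n + (1 - \<gamma>\<^sup>2) * \<sigma>\<^sup>2"
  shows "\<gamma> * \<sigma> \<le> sqrt (resid_var_nu \<nu> h u n)"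
proof -
  have nn: "0 \<le> resid_var_nu \<nu> h u n"
    by (rule resid_var_nonneg[OF u h])
  have "0 \<le> (1 - \<gamma>\<^sup>2) * \<sigma>\<^sup>2"
    using \<gamma> by (simp add: power_le_one)
  have "\<sigma> \<le> sqrt (resid_var_nu \<nu> h u n + (1 - \<gamma>\<^sup>2) * \<sigma>\<^sup>2)"
    by (subst \<sigma>_def, rule cSUP_least[OF \<open>P \<noteq> {}\<close>]) (simp add: gap)
  then have "\<sigma>\<^sup>2 \<le> (sqrt (resid_var_nu \<nu> h u n + (1 - \<gamma>\<^sup>2) * \<sigma>\<^sup>2))\<^sup>2"
    using \<sigma> by (intro power_mono)
  also have "\<dots> = resid_var_nu \<nu> h u n + (1 - \<gamma>\<^sup>2) * \<sigma>\<^sup>2"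
    using nn \<open>0 \<le> (1 - \<gamma>\<^sup>2) * \<sigma>\<^sup>2\<close> by simp
  finally have "(\<gamma> * \<sigma>)\<^sup>2 \<le> resid_var_nu \<nu> h u n"
    by (simp add: power_mult_distrib left_diff_distrib)
  then show ?thesis
    by (rule real_le_rsqrt)
qed

text \<open>One outcome is fixed: \<open>u\<close> is the selected family, \<open>z\<close> the
  current batch, \<open>m\<close> its size and \<open>\<mu>0\<close> the new selection. Randomness
  enters the inequality only through an assumed bound on \<open>emp_dev\<close>.\<close>

context
  fixes g :: "'b \<Rightarrow> 'a \<Rightarrow> real" and P :: "'b set" and u :: "nat \<Rightarrow> 'a \<Rightarrow> real" and \<mu>0 :: 'b
    and K2 Kinf KL \<gamma> \<sigma> :: real and n :: nat and z :: "nat \<Rightarrow> 'a" and m :: nat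
  assumes g: "\<And>\<mu>. \<mu> \<in> P \<Longrightarrow> g \<mu> \<in> blip0 \<nu>"
    and var_le: "\<And>\<mu>. \<mu> \<in> P \<Longrightarrow> sqrt (var_nu \<nu> (g \<mu>)) \<le> K2"
    and linf_le: "\<And>\<mu>. \<mu> \<in> P \<Longrightarrow> linf_norm (g \<mu>) \<le> Kinf"
    and lip_le: "\<And>\<mu>. \<mu> \<in> P \<Longrightarrow> lip_const (g \<mu>) \<le> KL"
    and u: "\<And>i. u i \<in> blip0 \<nu>" and \<mu>0: "\<mu>0 \<in> P"
    and pos: "0 < resid_var_nu \<nu> (g \<mu>0) u n"
    and \<gamma>: "0 < \<gamma>" "\<gamma> < 1"
    and \<sigma>: "\<sigma> = (SUP \<mu>\<in>P. sqrt (resid_var_nu \<nu> (g \<mu>) u n))"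
begin

lemma sigma_hat_pos: "0 < \<sigma>"
proof -
  have "bdd_above ((\<lambda>\<mu>. sqrt (resid_var_nu \<nu> (g \<mu>) u n)) ` P)"
    by (rule bdd_above_sqrt_resid_var[OF _ g u]) (auto intro!: bdd_aboveI2 var_le)
  then have "sqrt (resid_var_nu \<nu> (g \<mu>0) u n) \<le> \<sigma>"
    unfolding \<sigma> using \<mu>0 by (intro cSUP_upper)
  then show ?thesis
    using pos by (smt (verit) real_sqrt_gt_zero)
qed

lemma Kinf_KL_pos: "0 < Kinf" "0 < KL"
proof -
  have "0 < var_nu \<nu> (g \<mu>0)"
    using pos resid_var_le_var[where u = u and n = n, OF u g[OF \<mu>0]] by linarith
  then show "0 < Kinf" "0 < KL"
    using var_pos_imp_norms_pos[OF g[OF \<mu>0]] linf_le[OF \<mu>0] lip_le[OF \<mu>0] by (auto intro: less_le_trans)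
qed

lemma one_minus_gamma_sq_pos: "0 < 1 - \<gamma>\<^sup>2"
  using \<gamma> power_strict_mono[of \<gamma> 1 2] by simp

lemma family_lipschitz_bounded:
  assumes "\<mu> \<in> P"
  shows "KL-lipschitz_on UNIV (g \<mu>)" "\<bar>g \<mu> x\<bar> \<le> Kinf"
proof -
  have "bounded (range (g \<mu>))" "(lip_const (g \<mu>))-lipschitz_on UNIV (g \<mu>)"
    using g[OF assms] by (auto simp: blip0_def intro: lipschitz_on_lip_const)
  then show "KL-lipschitz_on UNIV (g \<mu>)" "\<bar>g \<mu> x\<bar> \<le> Kinf"
    using lipschitz_on_mono[OF _ subset_refl lip_le[OF assms]]
      order_trans[OF abs_le_linf_norm linf_le[OF assms]] by blast+
qed

lemma kappa_first_pos: "0 < (1 - \<gamma>\<^sup>2) * \<sigma>\<^sup>2 / (8 * Kinf * KL)"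
  using sigma_hat_pos Kinf_KL_pos one_minus_gamma_sq_pos by simp

lemma weak_greedy_first_step:
  assumes int: "integrable \<nu> (norm :: 'a \<Rightarrow> real)" and m: "1 \<le> m" and n: "n = 0"
    and dev: "emp_dev \<nu> z m \<le> (1 - \<gamma>\<^sup>2) * \<sigma>\<^sup>2 / (8 * Kinf * KL)"
    and argmax: "\<And>\<mu>. \<mu> \<in> P \<Longrightarrow> emp_resid_var z m (g \<mu>) u n \<le> emp_resid_var z m (g \<mu>0) u n"
  shows "\<gamma> * \<sigma> \<le> sqrt (resid_var_nu \<nu> (g \<mu>0) u n)"
proof (rule weak_greedy_of_resid_gap[OF \<sigma> u g[OF \<mu>0] _ g \<gamma>])
  let ?\<kappa> = "(1 - \<gamma>\<^sup>2) * \<sigma>\<^sup>2 / (8 * Kinf * KL)"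
  \<comment> \<open>Two deviations are paid, for \<mu> and for \<open>\<mu>0\<close>; together they
    use 3/4 of the gap. There are no coefficients to control at this step, so the error is purely
    additive.\<close>
  have e: "3 * Kinf * KL * ?\<kappa> = 3 / 8 * ((1 - \<gamma>\<^sup>2) * \<sigma>\<^sup>2)"
    using Kinf_KL_pos by (simp add: field_simps)
  have d: "\<bar>var_nu \<nu> (g \<mu>) - emp_var z m (g \<mu>)\<bar> \<le> 3 / 8 * ((1 - \<gamma>\<^sup>2) * \<sigma>\<^sup>2)" if "\<mu> \<in> P" for \<mu>
    using emp_cov_deviation[OF int m g[OF that] g[OF that] family_lipschitz_bounded(1)[OF that]
        family_lipschitz_bounded(1)[OF that] family_lipschitz_bounded(2)[OF that]
        family_lipschitz_bounded(2)[OF that] dev]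
    unfolding e by (simp add: var_nu_def emp_var_eq_emp_cov)
  fix \<mu> assume \<mu>: "\<mu> \<in> P"
  have "0 \<le> (1 - \<gamma>\<^sup>2) * \<sigma>\<^sup>2"
    using one_minus_gamma_sq_pos by simp
  then show "resid_var_nu \<nu> (g \<mu>) u n \<le> resid_var_nu \<nu> (g \<mu>0) u n + (1 - \<gamma>\<^sup>2) * \<sigma>\<^sup>2"
    using d[OF \<mu>] d[OF \<mu>0] argmax[OF \<mu>] unfolding n resid_var_0 emp_resid_var_0 by linarith
qed (use \<mu>0 sigma_hat_pos in auto)

context
  fixes Kn Ln :: real
  assumes Kn: "Kn = Max (insert Kinf (linf_norm ` set (gram_schmidt (cov_nu \<nu>) u n)))"
    and Ln: "Ln = Max (insert KL (lip_const ` set (gram_schmidt (cov_nu \<nu>) u n)))"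
    and n: "1 \<le> n"
begin

lemma Kn_Ln_pos: "0 < Kn" "0 < Ln"
proof -
  have "Kinf \<le> Kn" "KL \<le> Ln"
    unfolding Kn Ln by (auto intro!: Max_ge)
  then show "0 < Kn" "0 < Ln"
    using Kinf_KL_pos by auto
qed

lemma kappa_later_pos:
  "0 < min (1 / (2 * real n)) ((1 - \<gamma>\<^sup>2) * \<sigma>\<^sup>2 / (real (Suc n) * (9 * K2\<^sup>2 + 4))) / (6 * Kn * Ln)"
  using sigma_hat_pos Kn_Ln_pos one_minus_gamma_sq_pos n
  by (intro divide_pos_pos) (auto simp: min_less_iff_conj intro!: divide_pos_pos mult_pos_pos add_nonneg_pos)

text \<open>Here n counts the functions already selected, so this is iteration \<open>Suc n\<close>
  of the algorithm; hence \<open>2 * real n\<close> and \<open>real (Suc n)\<close> in the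
  threshold.\<close>

lemma weak_greedy_later_step:
  assumes int: "integrable \<nu> (norm :: 'a \<Rightarrow> real)" and m: "1 \<le> m"
    and nd: "\<And>i. i < n \<Longrightarrow> 0 < resid_var_nu \<nu> (u i) u i"
    and dev: "emp_dev \<nu> z m \<le>
      min (1 / (2 * real n)) ((1 - \<gamma>\<^sup>2) * \<sigma>\<^sup>2 / (real (Suc n) * (9 * K2\<^sup>2 + 4))) / (6 * Kn * Ln)"
    and argmax: "\<And>\<mu>. \<mu> \<in> P \<Longrightarrow> emp_resid_var z m (g \<mu>) u n \<le> emp_resid_var z m (g \<mu>0) u n"
  shows "\<gamma> * \<sigma> \<le> sqrt (resid_var_nu \<nu> (g \<mu>0) u n)"
proof (rule weak_greedy_of_resid_gap[OF \<sigma> u g[OF \<mu>0] _ g \<gamma>])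
  let ?min = "min (1 / (2 * real n)) ((1 - \<gamma>\<^sup>2) * \<sigma>\<^sup>2 / (real (Suc n) * (9 * K2\<^sup>2 + 4)))"
  \<comment> \<open>Half the minimum, because the covariance bound multiplies by 3 a threshold
    divided by 6.\<close>
  define \<eta> where "\<eta> = ?min / 2"
  have \<eta>_eq: "3 * Kn * Ln * (?min / (6 * Kn * Ln)) = \<eta>"
    using Kn_Ln_pos by (simp add: \<eta>_def field_simps)
  have "\<eta> \<le> 1 / (2 * real n) / 2"
    unfolding \<eta>_def by (intro divide_right_mono) auto
  \<comment> \<open>The first entry of the minimum is used: the product is at most (n + 1) / (2n),
    which is at most 1 since n is at least 1.\<close>
  then have "2 * \<eta> * real (Suc n) \<le> 2 * (1 / (2 * real n) / 2) * real (Suc n)"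
    by (intro mult_right_mono mult_left_mono) auto
  also have "\<dots> \<le> 1"
    using n by (simp add: field_simps)
  finally have small: "2 * \<eta> * real (Suc n) \<le> 1" .
  have D: "0 < 9 * K2\<^sup>2 + 4"
    by (intro add_nonneg_pos) auto
  \<comment> \<open>The second entry is used: \<open>Suc n\<close> cancels, and the constant
    \<open>9 * K2\<^sup>2 + 4\<close> dominates \<open>2 + 3 * K2\<^sup>2\<close>.\<close>
  have "\<eta> * real (Suc n) * (2 + 3 * K2\<^sup>2)
      \<le> ((1 - \<gamma>\<^sup>2) * \<sigma>\<^sup>2 / (real (Suc n) * (9 * K2\<^sup>2 + 4))) / 2 * real (Suc n) * (2 + 3 * K2\<^sup>2)"
    unfolding \<eta>_def by (intro mult_right_mono divide_right_mono) auto
  also have "\<dots> = (1 - \<gamma>\<^sup>2) * \<sigma>\<^sup>2 * ((2 + 3 * K2\<^sup>2) / (2 * (9 * K2\<^sup>2 + 4)))"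
  proof -
    have "x / (N * D) / 2 * N * q = x * (q / (2 * D))" if "N \<noteq> 0" "D \<noteq> 0" for x N D q :: real
      using that by (simp add: field_simps)
    then show ?thesis
      using D by simp
  qed
  also have "\<dots> \<le> (1 - \<gamma>\<^sup>2) * \<sigma>\<^sup>2 * 1"
    using D one_minus_gamma_sq_pos by (intro mult_left_mono) (auto simp: divide_le_eq)
  finally have err: "\<eta> * real (Suc n) * (2 + 3 * K2\<^sup>2) \<le> (1 - \<gamma>\<^sup>2) * \<sigma>\<^sup>2"
    by simp
  have good: "k \<in> blip0 \<nu> \<and> Ln-lipschitz_on UNIV k \<and> (\<forall>x. \<bar>k x\<bar> \<le> Kn)"
    if mem: "\<mu> \<in> P" "k \<in> insert (g \<mu>) (gs (cov_nu \<nu>) u ` {..<n})" for \<mu> k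
  proof -
    have k: "k \<in> blip0 \<nu>"
      using that g gs_blip0[OF u] by auto
    have "lip_const k \<le> Ln" "linf_norm k \<le> Kn"
    proof -
      have "set (gram_schmidt (cov_nu \<nu>) u n) = gs (cov_nu \<nu>) u ` {..<n}"
        by (simp add: gram_schmidt_eq_map atLeast0LessThan)
      then consider "k = g \<mu>" | "k \<in> set (gram_schmidt (cov_nu \<nu>) u n)"
        using mem(2) by auto
      then have "lip_const k \<le> Ln \<and> linf_norm k \<le> Kn"
      proof cases
        case 1
        have "KL \<le> Ln" "Kinf \<le> Kn"
          unfolding Kn Ln by (auto intro!: Max_ge)
        then show ?thesis
          using 1 lip_le[OF mem(1)] linf_le[OF mem(1)] by auto
      next
        case 2
        then show ?thesis
          unfolding Kn Ln by (auto intro!: Max_ge)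
      qed
      then show "lip_const k \<le> Ln" "linf_norm k \<le> Kn"
        by auto
    qed
    note le = this
    have bd: "bounded (range k)" and lip: "(lip_const k)-lipschitz_on UNIV k"
      using k by (auto simp: blip0_def intro: lipschitz_on_lip_const)
    show ?thesis
      using k lipschitz_on_mono[OF lip subset_refl le(1)] order_trans[OF abs_le_linf_norm[OF bd] le(2)]
      by blast
  qed
  have var_K2: "var_nu \<nu> (g \<mu>) \<le> K2\<^sup>2" if "\<mu> \<in> P" for \<mu>
    using var_le[OF that] var_nonneg[OF g[OF that]] by (simp add: sqrt_le_D)
  fix \<mu> assume \<mu>: "\<mu> \<in> P"
  have "\<bar>cov_nu \<nu> k l - emp_cov z m k l\<bar> \<le> \<eta>"
    if mem: "f \<in> {g \<mu>0, g \<mu>}" "k \<in> insert f (gs (cov_nu \<nu>) u ` {..<n})" "l \<in> insert f (gs (cov_nu \<nu>) u ` {..<n})" for f k l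
  proof -
    obtain \<mu>' where \<mu>': "\<mu>' \<in> P" "f = g \<mu>'"
      using mem(1) \<mu> \<mu>0 by auto
    show ?thesis
      using emp_cov_deviation[OF int m, of k l Ln Kn z "?min / (6 * Kn * Ln)"] dev
        good[OF \<mu>'(1), of k] good[OF \<mu>'(1), of l] mem \<mu>'(2) unfolding \<eta>_eq by auto
  qed
  then have "resid_var_nu \<nu> (g \<mu>) u n - \<eta> * real (Suc n) * (2 + 3 * K2\<^sup>2) \<le> resid_var_nu \<nu> (g \<mu>0) u n"
    by (intro resid_var_deviation[OF u g[OF \<mu>0] g[OF \<mu>] nd _ small var_K2[OF \<mu>0] var_K2[OF \<mu>] argmax[OF \<mu>]])
  then show "resid_var_nu \<nu> (g \<mu>) u n \<le> resid_var_nu \<nu> (g \<mu>0) u n + (1 - \<gamma>\<^sup>2) * \<sigma>\<^sup>2"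
    using err by linarith
qed (use \<mu>0 sigma_hat_pos in auto)

end
end
end

section \<open>From the inequality at fixed outcomes to conditional probabilities\<close>

theorem theorem2:
  fixes M :: "'w measure"
    and \<nu> :: "'a::euclidean_space measure"
    and Z :: "'w \<Rightarrow> 'a"
    and Zs :: "nat \<Rightarrow> nat \<Rightarrow> 'w \<Rightarrow> 'a"
    and \<alpha> \<beta> c C :: real
    and P :: "'b::euclidean_space set"
    and f :: "'b \<Rightarrow> 'a \<Rightarrow> real"
    and Ms :: "nat \<Rightarrow> 'w \<Rightarrow> nat"
    and mubar :: "nat \<Rightarrow> 'w \<Rightarrow> 'b"
    and \<delta> \<gamma> :: real
    and \<delta>s :: "nat \<Rightarrow> real"
  assumes g_def: "g = (\<lambda>\<mu>. centred \<nu> (f \<mu>))"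
    and K2_def: "K2 = (SUP \<mu>\<in>P. sqrt (var_nu \<nu> (g \<mu>)))"
    and KL_def: "KL = (SUP \<mu>\<in>P. lip_const (g \<mu>))"
    and Kinf_def: "Kinf = (SUP \<mu>\<in>P. linf_norm (g \<mu>))"
    and b_def: "b = (\<lambda>\<omega> i. g (mubar (Suc i) \<omega>))"
    and samp_def: "samp = (\<lambda>n \<omega> k. Zs n k \<omega>)"
    and sigma_hat_def: "sigma_hat = (\<lambda>m \<omega>. SUP \<mu>\<in>P. sqrt (resid_var_nu \<nu> (g \<mu>) (b \<omega>) m))"
    and sigma_bar_def: "sigma_bar = (\<lambda>m \<omega>. sqrt (resid_var_nu \<nu> (g (mubar (Suc m) \<omega>)) (b \<omega>) m))"
    and gbar_def: "gbar = (\<lambda>\<omega> m. gram_schmidt (cov_nu \<nu>) (b \<omega>) m)"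
    and Kinf_n_def: "Kinf_n = (\<lambda>m \<omega>. Max (insert Kinf (linf_norm ` set (gbar \<omega> m))))"
    and KL_n_def: "KL_n = (\<lambda>m \<omega>. Max (insert KL (lip_const ` set (gbar \<omega> m))))"
    and kappa_def: "\<kappa> = (\<lambda>m \<omega>. if m = 0
                 then (1 - \<gamma>^2) * (sigma_hat 0 \<omega>)^2 / (8 * Kinf * KL)
                 else min (1 / (2 * real m))
                          ((1 - \<gamma>^2) * (sigma_hat m \<omega>)^2 / (real (Suc m) * (9 * K2^2 + 4)))
                      / (6 * Kinf_n m \<omega> * KL_n m \<omega>))"
    and G_def: "G = (\<lambda>n. {\<omega> \<in> space M. sigma_bar (n - 1) \<omega> \<ge> \<gamma> * sigma_hat (n - 1) \<omega>})"
    and M_prob: "prob_space M"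
    and nu_prob: "prob_space \<nu>"
    and nu_borel: "sets \<nu> = sets borel"
    (* sampling: Z and all Zs n k (n >= 1) are independent with law nu *)
    and indep: "prob_space.indep_vars M (\<lambda>_. borel)
                  (\<lambda>i. case i of None \<Rightarrow> Z | Some (n, k) \<Rightarrow> Zs n k)
                  ({None} \<union> {Some (n, k) | n k. 1 \<le> n})"
    and Z_law: "distr M borel Z = \<nu>"
    and Zs_law: "\<And>n k. 1 \<le> n \<Longrightarrow> distr M borel (Zs n k) = \<nu>"
    (* Assumption (A) *)
    and A_alpha: "\<alpha> > 1" and A_beta: "\<beta> > 0"
    and A_int: "integrable \<nu> (\<lambda>x. exp (\<beta> * norm x powr \<alpha>))"
    (* the concentration constants c, C *)
    and c_pos: "c > 0" and C_pos: "C > 0"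
    and conc: "\<And>m \<kappa>'. m \<ge> 1 \<Longrightarrow> \<kappa>' > 0 \<Longrightarrow>
        measure (PiM {..<m} (\<lambda>_. \<nu>))
          {z \<in> space (PiM {..<m} (\<lambda>_. \<nu>)).
             (SUP h\<in>{h :: 'a \<Rightarrow> real. 1-lipschitz_on UNIV h}.
                \<bar>(\<integral>x. h x \<partial>\<nu>) - emp_mean z m h\<bar>) \<ge> \<kappa>'}
        \<le> C * exp (- c * real m * phi_conc DIM('a) \<alpha> \<kappa>')"
    (* the parametrised family *)
    and f_cont: "\<And>\<mu>. \<mu> \<in> P \<Longrightarrow> continuous_on UNIV (f \<mu>)"
    and f_L2: "\<And>\<mu>. \<mu> \<in> P \<Longrightarrow> integrable \<nu> (\<lambda>x. (f \<mu> x)^2)"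
    (* Assumption (B) *)
    and B1: "L2_compact \<nu> P g"
    and B1_bdd: "bdd_above ((\<lambda>\<mu>. sqrt (var_nu \<nu> (g \<mu>))) ` P)"
    and B2: "\<And>\<mu>. \<mu> \<in> P \<Longrightarrow> \<exists>L. L-lipschitz_on UNIV (g \<mu>)"
    and B2_bdd: "bdd_above ((\<lambda>\<mu>. lip_const (g \<mu>)) ` P)"
    and B3: "\<And>\<mu>. \<mu> \<in> P \<Longrightarrow> bounded (range (g \<mu>))"
    and B3_bdd: "bdd_above ((\<lambda>\<mu>. linf_norm (g \<mu>)) ` P)"
    and B4: "\<And>n. n \<ge> 1 \<Longrightarrow> kolmogorov_width \<nu> P g n > 0"
    (* the MC-greedy algorithm *)
    and mubar_in: "\<And>n \<omega>. n \<ge> 1 \<Longrightarrow> \<omega> \<in> space M \<Longrightarrow> mubar n \<omega> \<in> P"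
    and mubar_argmax: "\<And>n \<omega> \<mu>. n \<ge> 1 \<Longrightarrow> \<omega> \<in> space M \<Longrightarrow> \<mu> \<in> P \<Longrightarrow>
        emp_resid_var (samp n \<omega>) (Ms n \<omega>) (g \<mu>) (b \<omega>) (n - 1)
          \<le> emp_resid_var (samp n \<omega>) (Ms n \<omega>) (g (mubar n \<omega>)) (b \<omega>) (n - 1)"
    and mubar_nondeg: "\<And>n. n \<ge> 1 \<Longrightarrow> AE \<omega> in M.
        \<not> (\<exists>lam::nat \<Rightarrow> real. AE x in \<nu>. g (mubar n \<omega>) x = (\<Sum>i<n - 1. lam i * b \<omega> i x))"
    and mubar_meas: "\<And>n. n \<ge> 1 \<Longrightarrow> mubar n \<in> measurable (sample_alg M Zs n) borel"
    and gmubar_meas: "\<And>n x. n \<ge> 1 \<Longrightarrow>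
        (\<lambda>\<omega>. g (mubar n \<omega>) x) \<in> borel_measurable (sample_alg M Zs n)"
    (* the numbers of samples *)
    and Ms_meas: "\<And>n. n \<ge> 1 \<Longrightarrow> Ms n \<in> measurable (sample_alg M Zs (n - 1)) (count_space UNIV)"
    and Ms_pos: "\<And>n \<omega>. n \<ge> 1 \<Longrightarrow> \<omega> \<in> space M \<Longrightarrow> Ms n \<omega> \<ge> 1"
    (* confidence levels *)
    and delta: "0 < \<delta>" "\<delta> < 1"
    and deltas: "\<And>n. n \<ge> 1 \<Longrightarrow> 0 < \<delta>s n \<and> \<delta>s n < 1"
    and deltas_prod: "lim (\<lambda>N. \<Prod>n=1..N. 1 - \<delta>s n) \<ge> 1 - \<delta>"
    and gamma: "0 < \<gamma>" "\<gamma> < 1"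
    and Ms_large: "\<And>n. n \<ge> 1 \<Longrightarrow> AE \<omega> in M.
        real (Ms n \<omega>) \<ge> - ln (\<delta>s n / C) / (c * phi_conc DIM('a) \<alpha> (\<kappa> (n - 1) \<omega>))"
  shows "(\<forall>n\<ge>1. AE \<omega> in M.
            real_cond_exp M (sample_alg M Zs (n - 1)) (indicator (G n)) \<omega> \<ge> 1 - \<delta>s n)
         \<and> measure M (\<Inter>n\<in>{1..}. G n) \<ge> 1 - \<delta>"
proof -
  interpret M: prob_space M
    by (rule M_prob)
  interpret \<nu>: prob_space \<nu>
    by (rule nu_prob)
  interpret \<nu>: borel_prob_space \<nu>
    by unfold_locales (rule nu_borel)
  have int: "integrable \<nu> (norm :: 'a \<Rightarrow> real)"
    by (rule \<nu>.integrable_norm_of_exp_moment[OF A_alpha A_beta A_int])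
  have Zm: "Zs j k \<in> borel_measurable M" if "1 \<le> j" for j k
    by (rule M.samples_measurable[OF indep that])
  have sub: "subalgebra M (sample_alg M Zs n)" for n
    by (rule subalgebra_sample_alg[OF Zm])
  have g_blip0: "g \<mu> \<in> blip0 \<nu>" if "\<mu> \<in> P" for \<mu>
  proof -
    have "f \<mu> \<in> borel_measurable \<nu>"
      using borel_measurable_continuous_onI[OF f_cont[OF that]] by (simp add: measurable_cong_sets[OF nu_borel refl])
    then have "integrable \<nu> (f \<mu>)"
      by (rule \<nu>.square_integrable_imp_integrable[OF _ f_L2[OF that]])
    then have "(\<integral>x. g \<mu> x \<partial>\<nu>) = 0"
      by (simp add: g_def centred_def \<nu>.prob_space)
    then show ?thesis
      using B2[OF that] B3[OF that] by (simp add: blip0_def)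
  qed
  have "space M \<noteq> {}"
    by (rule M.not_empty)
  then have "P \<noteq> {}"
    using mubar_in[of 1] by auto
  have b_blip0: "b \<omega> i \<in> blip0 \<nu>" if "\<omega> \<in> space M" for \<omega> i
    using mubar_in[of "Suc i" \<omega>] that by (simp add: b_def g_blip0)
  \<comment> \<open>\<open>b \<omega> i\<close> is the selection of iteration \<open>Suc i\<close>,
    so the indices below n are those known after n batches.\<close>
  have b_meas: "(\<lambda>p. b (fst p) i (snd p)) \<in> borel_measurable (sample_alg M Zs n \<Otimes>\<^sub>M \<nu>)" if "i < n" for i n
  proof (rule borel_measurable_pair_continuous[OF _ _ nu_borel])
    show "(\<lambda>\<omega>. b \<omega> i x) \<in> borel_measurable (sample_alg M Zs n)" for x
    proof (rule measurable_from_subalg)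
      show "subalgebra (sample_alg M Zs n) (sample_alg M Zs (Suc i))"
        using sets_sample_alg_mono[of "Suc i" n M Zs] that by (simp add: subalgebra_def)
      show "(\<lambda>\<omega>. b \<omega> i x) \<in> borel_measurable (sample_alg M Zs (Suc i))"
        using gmubar_meas[of "Suc i" x] by (simp add: b_def)
    qed
    show "continuous_on UNIV (b \<omega> i)" if "\<omega> \<in> space (sample_alg M Zs n)" for \<omega>
      using that b_blip0 by (simp add: \<nu>.blip0_continuous)
  qed
  have G_meas: "G n \<in> sets (sample_alg M Zs n)" if n: "1 \<le> n" for n
  proof -
    have "(\<lambda>\<omega>. resid_var_nu \<nu> (b \<omega> (n - 1)) (b \<omega>) (n - 1)) \<in> borel_measurable (sample_alg M Zs n)"
      using n by (intro \<nu>.resid_var_measurable b_meas) (auto intro: b_blip0)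
    then have 1: "sigma_bar (n - 1) \<in> borel_measurable (sample_alg M Zs n)"
      unfolding sigma_bar_def b_def by simp
    have 2: "sigma_hat (n - 1) \<in> borel_measurable (sample_alg M Zs n)"
      unfolding sigma_hat_def
      using n by (intro \<nu>.SUP_resid_var_measurable[OF B1 g_blip0 B1_bdd \<open>P \<noteq> {}\<close> b_meas])
        (auto intro: b_blip0)
    have "{\<omega> \<in> space (sample_alg M Zs n). \<gamma> * sigma_hat (n - 1) \<omega> \<le> sigma_bar (n - 1) \<omega>} \<in> sets (sample_alg M Zs n)"
      using 1 2 by (intro borel_measurable_le borel_measurable_times) auto
    then show ?thesis
      by (simp add: G_def)
  qed
  \<comment> \<open>Positivity is part of the definition because the concentration bound is
    available only for positive thresholds; it also bounds the set below.\<close>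
  define S where "S n m = {\<kappa>' :: real. 0 < \<kappa>' \<and> - ln (\<delta>s n / C) / (c * phi_conc DIM('a) \<alpha> \<kappa>') \<le> real m}"
    for n m
  define Q where "Q n = {\<omega> \<in> space M. \<exists>\<kappa>'\<in>S n (Ms n \<omega>). \<kappa>' \<le> emp_dev \<nu> (\<lambda>k. Zs n k \<omega>) (Ms n \<omega>)}" for n
  have Q: "Q n \<in> sets M" "A \<in> sets (sample_alg M Zs (n - 1)) \<Longrightarrow> M.prob (A \<inter> Q n) \<le> \<delta>s n * M.prob A"
    if n: "1 \<le> n" for n A
  proof -
    have S_bdd: "bdd_below (S n m)" for m
      by (rule bdd_belowI[of _ 0]) (simp add: S_def)
    have S_conc: "measure (PiM {..<m} (\<lambda>_. \<nu>)) {z \<in> space (PiM {..<m} (\<lambda>_. \<nu>)). \<kappa>' \<le> emp_dev \<nu> z m} \<le> \<delta>s n"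
      if "1 \<le> m" "\<kappa>' \<in> S n m" for m \<kappa>'
    proof -
      have \<kappa>': "0 < \<kappa>'" "- ln (\<delta>s n / C) / (c * phi_conc DIM('a) \<alpha> \<kappa>') \<le> real m"
        using that(2) by (auto simp: S_def)
      have "measure (PiM {..<m} (\<lambda>_. \<nu>)) {z \<in> space (PiM {..<m} (\<lambda>_. \<nu>)). \<kappa>' \<le> emp_dev \<nu> z m}
          \<le> C * exp (- c * real m * phi_conc DIM('a) \<alpha> \<kappa>')"
        unfolding emp_dev_def by (rule conc[OF that(1) \<kappa>'(1)])
      also have "\<dots> \<le> \<delta>s n"
        using deltas[OF n] by (intro conc_bound_le c_pos C_pos \<kappa>') auto
      finally show ?thesis .
    qed
    have d: "0 \<le> \<delta>s n"
      using deltas[OF n] by simp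
    show "Q n \<in> sets M"
      unfolding Q_def
      by (rule M.prob_past_deviation(1)[OF indep Zs_law int n Ms_meas[OF n] Ms_pos[OF n] S_bdd d S_conc sets.top])
    show "M.prob (A \<inter> Q n) \<le> \<delta>s n * M.prob A" if "A \<in> sets (sample_alg M Zs (n - 1))"
      unfolding Q_def
      by (rule M.prob_past_deviation(2)[OF indep Zs_law int n Ms_meas[OF n] Ms_pos[OF n] S_bdd d S_conc that])
  qed
  have nondeg: "AE \<omega> in M. \<forall>j. \<not> (\<exists>lam::nat \<Rightarrow> real. AE x in \<nu>. b \<omega> j x = (\<Sum>i<j. lam i * b \<omega> i x))"
    unfolding AE_all_countable
  proof
    fix j :: nat
    show "AE \<omega> in M. \<not> (\<exists>lam::nat \<Rightarrow> real. AE x in \<nu>. b \<omega> j x = (\<Sum>i<j. lam i * b \<omega> i x))"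
      using mubar_nondeg[of "Suc j"] by (simp add: b_def)
  qed
  \<comment> \<open>All exceptional sets are confined to this statement. Outside them the threshold
    is positive and lies in \<open>S n (Ms n \<omega>)\<close>, so a failure of the greedy
    inequality forces the outcome into \<open>Q n\<close>.\<close>
  have cover: "AE \<omega> in M. \<omega> \<in> G n \<or> \<omega> \<in> Q n" if n: "1 \<le> n" for n
    using nondeg Ms_large[OF n] AE_space
  proof eventually_elim
    case (elim \<omega>)
    then have \<omega>: "\<omega> \<in> space M"
      by simp
    let ?m = "Ms n \<omega>" and ?z = "samp n \<omega>" and ?\<mu> = "mubar n \<omega>"
    have nd: "0 < resid_var_nu \<nu> (b \<omega> j) (b \<omega>) j" for j
      using elim(1) by (intro \<nu>.resid_var_pos b_blip0[OF \<omega>]) auto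
    have b_n: "b \<omega> (n - 1) = g ?\<mu>"
      using n by (simp add: b_def)
    have pos: "0 < resid_var_nu \<nu> (g ?\<mu>) (b \<omega>) (n - 1)"
      using nd[of "n - 1"] unfolding b_n .
    have \<mu>: "?\<mu> \<in> P"
      by (rule mubar_in[OF n \<omega>])
    have var_le: "sqrt (var_nu \<nu> (g \<mu>)) \<le> K2" if "\<mu> \<in> P" for \<mu>
      unfolding K2_def by (rule cSUP_upper[OF that B1_bdd])
    have linf_le: "linf_norm (g \<mu>) \<le> Kinf" if "\<mu> \<in> P" for \<mu>
      unfolding Kinf_def by (rule cSUP_upper[OF that B3_bdd])
    have lip_le: "lip_const (g \<mu>) \<le> KL" if "\<mu> \<in> P" for \<mu>
      unfolding KL_def by (rule cSUP_upper[OF that B2_bdd])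
    have \<sigma>: "sigma_hat (n - 1) \<omega> = (SUP \<mu>\<in>P. sqrt (resid_var_nu \<nu> (g \<mu>) (b \<omega>) (n - 1)))"
      by (simp add: sigma_hat_def)
    note family = g_blip0 var_le linf_le lip_le b_blip0[OF \<omega>] \<mu> pos gamma \<sigma>
    have Kn: "Kinf_n (n - 1) \<omega> = Max (insert Kinf (linf_norm ` set (gram_schmidt (cov_nu \<nu>) (b \<omega>) (n - 1))))"
      and Ln: "KL_n (n - 1) \<omega> = Max (insert KL (lip_const ` set (gram_schmidt (cov_nu \<nu>) (b \<omega>) (n - 1))))"
      by (simp_all add: Kinf_n_def KL_n_def gbar_def)
    have "0 < \<kappa> (n - 1) \<omega>"
    proof (cases "n - 1 = 0")
      case True
      then show ?thesis
        using \<nu>.kappa_first_pos[OF family] by (simp add: kappa_def)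
    next
      case False
      then show ?thesis
        using \<nu>.kappa_later_pos[OF family Kn Ln] by (simp add: kappa_def)
    qed
    then have \<kappa>_S: "\<kappa> (n - 1) \<omega> \<in> S n ?m"
      using elim(2) by (simp add: S_def)
    have "\<gamma> * sigma_hat (n - 1) \<omega> \<le> sqrt (resid_var_nu \<nu> (g ?\<mu>) (b \<omega>) (n - 1))"
      if dev: "emp_dev \<nu> ?z ?m \<le> \<kappa> (n - 1) \<omega>"
    proof (cases "n - 1 = 0")
      case True
      show ?thesis
        using dev True
        by (intro \<nu>.weak_greedy_first_step[OF family int Ms_pos[OF n \<omega>] True _ mubar_argmax[OF n \<omega>]])
          (simp_all add: kappa_def)
    next
      case False
      then have "1 \<le> n - 1"
        by simp
      then show ?thesis
        using dev False
        by (intro \<nu>.weak_greedy_later_step[OF family Kn Ln _ int Ms_pos[OF n \<omega>] nd _ mubar_argmax[OF n \<omega>]])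
          (simp_all add: kappa_def)
    qed
    moreover have "sigma_bar (n - 1) \<omega> = sqrt (resid_var_nu \<nu> (g ?\<mu>) (b \<omega>) (n - 1))"
      using n by (simp add: sigma_bar_def)
    ultimately show ?case
    proof (cases "emp_dev \<nu> ?z ?m \<le> \<kappa> (n - 1) \<omega>")
      case False
      \<comment> \<open>The actual random threshold is the witness for the existential quantifier in
        \<open>Q n\<close>.\<close>
      then have "\<omega> \<in> Q n"
        using \<omega> \<kappa>_S by (auto simp: Q_def samp_def intro!: bexI[of _ "\<kappa> (n - 1) \<omega>"])
      then show ?thesis ..
    qed (simp add: G_def \<omega>)
  qed
  have ge: "(1 - \<delta>s n) * M.prob A \<le> M.prob (A \<inter> G n)" if n: "1 \<le> n" and A: "A \<in> sets (sample_alg M Zs (n - 1))" for n A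
  proof -
    have ev: "A \<in> sets M" "G n \<in> sets M"
      using A G_meas[OF n] sub by (auto simp: subalgebra_def)
    \<comment> \<open>Almost all of \<open>A\<close> is covered by \<open>G n\<close> and
      \<open>Q n\<close>, and the part in \<open>Q n\<close> has at most the proportion
      \<open>\<delta>s n\<close>.\<close>
    have "M.prob A \<le> M.prob ((A \<inter> G n) \<union> (A \<inter> Q n))"
      using cover[OF n] ev Q(1)[OF n] by (intro M.finite_measure_mono_AE) auto
    also have "\<dots> \<le> M.prob (A \<inter> G n) + M.prob (A \<inter> Q n)"
      using ev Q(1)[OF n] by (intro measure_Un_le) auto
    also have "\<dots> \<le> M.prob (A \<inter> G n) + \<delta>s n * M.prob A"
      using Q(2)[OF n A] by simp
    finally show ?thesis
      by (simp add: algebra_simps)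
  qed
  have "AE \<omega> in M. 1 - \<delta>s n \<le> real_cond_exp M (sample_alg M Zs (n - 1)) (indicator (G n)) \<omega>" if "1 \<le> n" for n
    using G_meas[OF that] sub[of n] ge[OF that]
    by (intro M.real_cond_exp_indicator_ge sub) (auto simp: subalgebra_def)
  moreover have "lim (\<lambda>N. \<Prod>n=1..N. 1 - \<delta>s n) \<le> M.prob (\<Inter>n\<in>{1..}. G n)"
    using deltas
    by (intro M.prob_INT_ge_of_conditional[where F = "sample_alg M Zs"] sub sets_sample_alg_mono G_meas ge)
       (auto intro: less_imp_le)
  ultimately show ?thesis
    using deltas_prod by auto
qed

end
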